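(* Let $q=p^m$ be an odd prime power ($p$ prime, $m\in\mathbb{N}$) and let $k\in\mathbb{N}$ with $k\mid q-1$. Let $\Gamma=\Gamma(k,q)$ and let $\mu_\Gamma$ be the number of distinct eigenvalues of $\Gamma$. If $\Gamma$ is directed, then $\mu_\Gamma\ge 3$. Moreover, $\mu_\Gamma=3$ if and only if $k=2\frac{p^m-1}{p^a-1}$ where $a=\mathrm{ord}_n(p)$ with $n=\frac{q-1}{k}$, and $p^a\equiv 3 \pmod 4$. In this case $a$ is odd, $p\equiv 3\pmod 4$, $\Gamma$ is isomorphic to the disjoint union of $p^{m-a}$ copies of the directed Paley graph $\Gamma(2,p^a)$, and $$Spec(\Gamma)=\left\{\left[\tfrac{p^a-1}{2}\right]^{p^{m-a}},\ \left[\tfrac{-1+i\,p^{\frac{a-1}{2}}\sqrt p}{2}\right]^{\frac{p^a-1}{2}p^{m-a}},\ \left[\tfrac{-1-i\,p^{\frac{a-1}{2}}\sqrt p}{2}\right]^{\frac{p^a-1}{2}p^{m-a}}\right\}.$$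
   Context: $R_k=\{x^k:x\in\mathbb{F}_q^*\}$; the generalized Paley graph $\Gamma(k,q)$ has vertex set $\mathbb{F}_q$ and an arc $x\to y$ iff $y-x\in R_k$; it is directed iff $R_k\neq -R_k$. For a prime power $r\equiv 3\pmod 4$, $\Gamma(2,r)$ is the directed Paley graph. $\mathrm{ord}_n(p)$ is the multiplicative order of $p$ modulo $n$. $Spec$ is the multiset of adjacency eigenvalues, written $\{[\lambda]^{\text{mult}}\}$. *)

theory Defs
  imports
    "HOL-Library.Cardinality"
    "HOL-Number_Theory.Number_Theory"
    "Graph_Theory.Digraph_Isomorphism"
    "Jordan_Normal_Form.Spectral_Radius"
begin

definition nonzero_powers :: "nat \<Rightarrow> 'a::field set" where
  "nonzero_powers k = {x ^ k | x. x \<noteq> 0}"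

text \<open>The type \<^typ>\<open>'a\<close> plays the role of the field with \<open>q\<close> elements.\<close>

definition gen_paley :: "nat \<Rightarrow> ('a::field, 'a \<times> 'a) pre_digraph" where
  "gen_paley k =
     \<lparr> verts = UNIV, arcs = {(x, y). y - x \<in> nonzero_powers k}, tail = fst, head = snd \<rparr>"

lemma arcs_ends_gen_paley:
  "arcs_ends (gen_paley k :: ('a::field, 'a \<times> 'a) pre_digraph) =
     {(x, y). y - x \<in> nonzero_powers k}"
  by (auto simp: gen_paley_def arcs_ends_def arc_to_ends_def)

lemma symmetric_gen_paley_iff:
  "symmetric (gen_paley k :: ('a::field, 'a \<times> 'a) pre_digraph) \<longleftrightarrow>
     (nonzero_powers k :: 'a set) = uminus ` nonzero_powers k"
proof
  assume "symmetric (gen_paley k :: ('a, 'a \<times> 'a) pre_digraph)"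
  then have *: "x - y \<in> nonzero_powers k" if "y - x \<in> nonzero_powers k" for x y :: 'a
    using that by (auto simp: symmetric_def arcs_ends_gen_paley sym_def)
  have **: "- x \<in> nonzero_powers k" if "x \<in> nonzero_powers k" for x :: 'a
    using *[of x 0] that by simp
  show "(nonzero_powers k :: 'a set) = uminus ` nonzero_powers k"
    using ** by (force simp: image_iff)
next
  assume eq: "(nonzero_powers k :: 'a set) = uminus ` nonzero_powers k"
  have "x - y \<in> nonzero_powers k" if "y - x \<in> nonzero_powers k" for x y :: 'a
  proof -
    have "- (y - x) \<in> uminus ` nonzero_powers k" using that by (rule imageI)
    then show ?thesis using eq by simp
  qed
  then show "symmetric (gen_paley k :: ('a, 'a \<times> 'a) pre_digraph)"
    by (auto simp: symmetric_def arcs_ends_gen_paley sym_def)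
qed

definition disjoint_copies :: "nat \<Rightarrow> ('v, 'e) pre_digraph \<Rightarrow> (nat \<times> 'v, nat \<times> 'e) pre_digraph" where
  "disjoint_copies c G =
     \<lparr> verts = {..<c} \<times> verts G, arcs = {..<c} \<times> arcs G,
       tail = map_prod id (tail G), head = map_prod id (head G) \<rparr>"

text \<open>
  The 0/1 matrix below is the adjacency matrix for digraphs with finitely many vertices and no
  parallel arcs. It depends on an enumeration of the vertices, but its characteristic
  polynomial does not (\<open>char_poly_adj_matrix_wrt\<close>), so fixing an arbitrary enumeration is harmless.
\<close>

definition adj_matrix_wrt :: "'v list \<Rightarrow> ('v, 'e) pre_digraph \<Rightarrow> complex mat" where
  "adj_matrix_wrt vs G =
     mat (length vs) (length vs) (\<lambda>(i, j). if vs ! i \<rightarrow>\<^bsub>G\<^esub> vs ! j then 1 else 0)"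

definition adj_matrix :: "('v, 'e) pre_digraph \<Rightarrow> complex mat" where
  "adj_matrix G = adj_matrix_wrt (SOME vs. distinct vs \<and> set vs = verts G) G"

definition graph_Spec :: "('v, 'e) pre_digraph \<Rightarrow> complex multiset" where
  "graph_Spec G = proots (char_poly (adj_matrix G))"

definition num_distinct_eigenvalues :: "('v, 'e) pre_digraph \<Rightarrow> nat" where
  "num_distinct_eigenvalues G = card {l. eigenvalue (adj_matrix G) l}"

lemma char_poly_adj_matrix_wrt_cong:
  assumes "distinct vs" "distinct ws" "set vs = set ws"
  shows "char_poly (adj_matrix_wrt vs G) = char_poly (adj_matrix_wrt ws G)"
proof -
  let ?n = "length ws"
  have "mset vs = mset ws"
    using assms by (simp add: set_eq_iff_mset_eq_distinct)
  then obtain f where f: "f permutes {..<?n}" "permute_list f ws = vs"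
    by (rule mset_eq_permutation)
  have len: "length vs = ?n" using f(2) by auto
  have nth: "vs ! i = ws ! f i" if "i < ?n" for i
    using f that by (metis permute_list_nth)
  have lt: "f i < ?n" if "i < ?n" for i
    using f(1) that by (metis lessThan_iff permutes_in_image)
  have inj: "f i = f j \<longleftrightarrow> i = j" for i j
    using f(1) by (metis permutes_inj inj_eq)
  have f': "f permutes {0..<?n}" using f(1) by (simp add: atLeast0LessThan)
  define C where "C = char_poly_matrix (adj_matrix_wrt ws G)"
  define D where "D = mat ?n ?n (\<lambda>(i, j). C\<^sup>T $$ (f i, j))"
  have C: "C \<in> carrier_mat ?n ?n"
    unfolding C_def by (rule char_poly_matrix_closed) (simp add: adj_matrix_wrt_def)
  then have CT: "C\<^sup>T \<in> carrier_mat ?n ?n" by simp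
  have D: "D \<in> carrier_mat ?n ?n" by (simp add: D_def)
  have "char_poly_matrix (adj_matrix_wrt vs G) = mat ?n ?n (\<lambda>(i, j). D\<^sup>T $$ (f i, j))"
    using C by (intro eq_matI)
      (auto simp: D_def C_def char_poly_matrix_def adj_matrix_wrt_def len nth lt inj)
  then have "char_poly (adj_matrix_wrt vs G) = det (mat ?n ?n (\<lambda>(i, j). D\<^sup>T $$ (f i, j)))"
    by (simp add: char_poly_def)
  also have "\<dots> = signof f * det (D\<^sup>T)"
    by (rule det_permute_rows) (use D f' in auto)
  also have "det (D\<^sup>T) = det D" using D by (rule det_transpose)
  also have "det D = signof f * det (C\<^sup>T)"
    unfolding D_def by (rule det_permute_rows) (use CT f' in auto)
  also have "det (C\<^sup>T) = det C" using C by (rule det_transpose)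
  also have "signof f * (signof f * det C) = det C"
    by (simp add: sign_def)
  finally show ?thesis by (simp add: C_def char_poly_def)
qed

lemma char_poly_adj_matrix_wrt:
  assumes "distinct vs" "set vs = verts G"
  shows "char_poly (adj_matrix_wrt vs G) = char_poly (adj_matrix G)"
proof -
  let ?P = "\<lambda>ws. distinct ws \<and> set ws = verts G"
  have "?P (SOME ws. ?P ws)"
    using assms by (intro someI[of ?P vs]) auto
  then show ?thesis
    unfolding adj_matrix_def by (intro char_poly_adj_matrix_wrt_cong) (use assms in auto)
qed

lemma num_distinct_eigenvalues_eq_card_graph_Spec:
  "num_distinct_eigenvalues G = card (set_mset (graph_Spec G))"
proof -
  have A: "adj_matrix G \<in> carrier_mat (dim_row (adj_matrix G)) (dim_row (adj_matrix G))"
    by (simp add: adj_matrix_def adj_matrix_wrt_def)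
  have "char_poly (adj_matrix G) \<noteq> 0"
    using degree_monic_char_poly[OF A] by auto
  then show ?thesis
    by (simp add: num_distinct_eigenvalues_def graph_Spec_def eigenvalue_root_char_poly[OF A])
qed

end

theory Submission
  imports Defs
begin

text \<open>
  Fix a nontrivial additive character \<open>\<psi>\<close> of the field. The eigenvalues of the graph, with
  multiplicity, are the periods \<open>\<lambda>\<^sub>c = (\<Sum>r\<in>R. \<psi> (c r))\<close>, where \<open>c\<close> runs through the field and \<open>R\<close> is the
  group of nonzero \<open>k\<close>-th powers, of order \<open>n\<close>. If the graph is directed then \<open>n\<close> is odd,
  \<open>- 1 \<notin> R\<close>, and by Fourier inversion some period is not real; together with its conjugate and
  \<open>\<lambda>\<^sub>0 = n\<close> this gives three eigenvalues.

  The additive span \<open>H\<close> of \<open>R\<close> is the subfield with \<open>p\<^sup>a\<close> elements, and \<open>\<lambda>\<^sub>c = n\<close> exactly if \<open>c\<close>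
  annihilates \<open>H\<close>. If there are only three eigenvalues then \<open>\<lambda>\<^sub>c + \<lambda>\<^sub>-\<^sub>c\<close> takes a single value off the
  annihilator, so Fourier inversion forces \<open>H - {0} = R \<union> - R\<close>, that is \<open>p\<^sup>a = 2 n + 1\<close>.
  Conversely, this equation makes \<open>R\<close> the set of nonzero squares of \<open>H\<close>, determines all periods,
  and identifies each coset of \<open>H\<close> with a Paley digraph.
\<close>

section \<open>Finite fields\<close>

lemma finite_field_generator:
  obtains g :: "'a::{field,finite}" where "g \<noteq> 0" "\<And>x. x \<noteq> 0 \<Longrightarrow> \<exists>i::nat. x = g ^ i"
proof -
  have pow: "x [^]\<^bsub>(class_ring :: 'a ring)\<^esub> i = x ^ i" for x :: 'a and i :: nat
    by (induction i) (simp_all add: class_ring_simps nat_pow_def mult.commute)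
  have carr: "carrier (mult_of (class_ring :: 'a ring)) = UNIV - {0}"
    by (simp add: class_ring_simps)
  have fin: "finite (carrier (class_ring :: 'a ring))" by simp
  obtain g :: 'a where "g \<in> UNIV - {0}" "UNIV - {0} = {g ^ i | i::nat. i \<in> UNIV}"
    using field.finite_field_mult_group_has_gen[OF class_field fin] unfolding carr pow by (rule bexE)
  then show thesis by (intro that[of g]) blast+
qed

text \<open>Multiplication by \<open>w\<close> permutes \<open>S\<close>, so \<open>\<Prod>S\<close>
  absorbs the factor \<open>w ^ card S\<close>; cancelling the nonzero product gives 1. It serves
  for the nonzero elements of a field and of a subring.\<close>

lemma power_card_eq_1:
  fixes w :: "'a::field"
  assumes "finite S" "0 \<notin> S" "w \<noteq> 0" "\<And>x. x \<in> S \<Longrightarrow> w * x \<in> S"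
  shows "w ^ card S = 1"
proof -
  have inj: "inj_on ((*) w) S" using assms(3) by (auto simp: inj_on_def)
  have "(*) w ` S = S"
    by (rule card_subset_eq) (use assms inj in \<open>auto simp: card_image\<close>)
  then have "\<Prod>S = (\<Prod>x\<in>S. w * x)"
    by (metis (no_types, lifting) inj prod.reindex_cong)
  also have "\<dots> = w ^ card S * \<Prod>S" by (simp add: prod.distrib)
  finally show ?thesis using assms by simp
qed

lemma finite_field_power_CARD:
  fixes x :: "'a::{field,finite}"
  shows "x ^ CARD('a) = x"
proof (cases "x = 0")
  case False
  then have "x ^ card (UNIV - {0::'a}) = 1"
    by (intro power_card_eq_1) auto
  then have "x ^ (CARD('a) - 1) = 1" by (simp add: card_Diff_singleton)
  then show ?thesis
    by (metis finite_UNIV_card_ge_0 finite power_minus_mult mult_1)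
qed simp

text \<open>If \<open>g ^ d = 1\<close> with \<open>d > 0\<close>, then the first \<open>d\<close>
  powers of \<open>g\<close> already exhaust the nonzero elements, which bounds \<open>d\<close>
  from below. This rules out a nonzero remainder of \<open>i\<close>.\<close>

lemma generator_power_eq_1_iff:
  fixes g :: "'a::{field,finite}"
  assumes g: "g \<noteq> 0" "\<And>x. x \<noteq> 0 \<Longrightarrow> \<exists>i::nat. x = g ^ i"
  shows "g ^ i = 1 \<longleftrightarrow> CARD('a) - 1 dvd i"
proof -
  let ?N = "CARD('a) - 1"
  have card: "card (UNIV - {0::'a}) = ?N" by (simp add: card_Diff_singleton)
  have 1: "g ^ ?N = 1"
    using power_card_eq_1[of "UNIV - {0}" g] g(1) card by simp
  have pow_mod: "g ^ j = g ^ (j mod d)" if "g ^ d = 1" for j d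
    by (metis mod_mult_div_eq mult.right_neutral power_add power_mult power_one that)
  have le: "?N \<le> d" if "d > 0" "g ^ d = 1" for d
  proof -
    have "x \<in> (\<lambda>j. g ^ j) ` {..<d}" if "x \<noteq> 0" for x
      using g(2)[OF that] pow_mod[OF \<open>g ^ d = 1\<close>] \<open>d > 0\<close> by fastforce
    then have "UNIV - {0} \<subseteq> (\<lambda>j. g ^ j) ` {..<d}" by auto
    then show ?thesis
      using card card_mono card_image_le by (metis card_lessThan finite finite_lessThan order_trans)
  qed
  have N: "?N > 0"
    by (metis card card_gt_0_iff finite insert_Diff_single Diff_eq_empty_iff UNIV_I singletonD
        subsetD zero_neq_one)
  show ?thesis
  proof
    assume "g ^ i = 1"
    then have "g ^ (i mod ?N) = 1" using pow_mod[OF 1] by simp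
    then have "i mod ?N = 0" using le N by (metis gr_zeroI mod_less_divisor not_le)
    then show "?N dvd i" by auto
  next
    assume "?N dvd i"
    then show "g ^ i = 1" using 1 by (auto simp: power_mult)
  qed
qed

lemma nonzero_powers_generator:
  fixes k :: nat
  assumes "k dvd CARD('a::{field,finite}) - 1" "n = (CARD('a::{field,finite}) - 1) div k"
  obtains w :: "'a::{field,finite}" where "w \<noteq> 0" "nonzero_powers k = range (\<lambda>i::nat. w ^ i)"
    "\<And>i. w ^ i = 1 \<longleftrightarrow> n dvd i"
proof -
  obtain g :: 'a where g: "g \<noteq> 0" "\<And>x. x \<noteq> 0 \<Longrightarrow> \<exists>i::nat. x = g ^ i"
    by (rule finite_field_generator) blast
  have N: "CARD('a) - 1 > 0"
    using card_mono[of "UNIV :: 'a set" "{0, 1}"] by simp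
  have nk: "CARD('a) - 1 = k * n" using assms by simp
  then have k: "k > 0" using N by (intro gr0I) auto
  show thesis
  proof
    show "g ^ k \<noteq> 0" using g by simp
    show "nonzero_powers k = range (\<lambda>i::nat. (g ^ k) ^ i)"
    proof (intro equalityI subsetI)
      fix x :: 'a assume "x \<in> nonzero_powers k"
      then obtain y where "x = y ^ k" "y \<noteq> 0" by (auto simp: nonzero_powers_def)
      moreover obtain i where "y = g ^ i" using g(2)[OF \<open>y \<noteq> 0\<close>] by blast
      ultimately have "x = (g ^ k) ^ i" by (simp add: power_mult[symmetric] mult.commute[of i k])
      then show "x \<in> range (\<lambda>i::nat. (g ^ k) ^ i)" by blast
    next
      fix x :: 'a assume "x \<in> range (\<lambda>i::nat. (g ^ k) ^ i)"
      then obtain i where "x = (g ^ k) ^ i" by blast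
      then have "x = (g ^ i) ^ k" by (simp add: power_mult[symmetric] mult.commute[of i k])
      then show "x \<in> nonzero_powers k" using g(1) unfolding nonzero_powers_def
        by (intro CollectI exI[of _ "g ^ i"]) simp
    qed
    show "(g ^ k) ^ i = 1 \<longleftrightarrow> n dvd i" for i
      using k nk generator_power_eq_1_iff[OF g, of "k * i"] by (simp add: power_mult[symmetric])
  qed
qed

lemma CHAR_finite_field:
  assumes "prime p" "CARD('a::{field,finite}) = p ^ m"
  shows "CHAR('a) = p"
proof -
  have pos: "CHAR('a) > 0" by (simp add: finite_imp_CHAR_pos)
  have "CHAR('a) dvd p ^ m" using CHAR_dvd_CARD[where 'a = 'a] assms by simp
  moreover have "prime CHAR('a)" using prime_CHAR_semidom[where 'a='a] pos by simp
  ultimately show ?thesis using assms(1) by (metis prime_dvd_power primes_dvd_imp_eq)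
qed

section \<open>Additive characters\<close>

text \<open>These are the additive subgroups.\<close>

definition diff_closed :: "'a::ab_group_add set \<Rightarrow> bool" where
  "diff_closed M \<longleftrightarrow> 0 \<in> M \<and> (\<forall>x\<in>M. \<forall>y\<in>M. x - y \<in> M)"

lemma diff_closedD:
  assumes "diff_closed M"
  shows diff_closed_0: "0 \<in> M"
    and diff_closed_diff: "x \<in> M \<Longrightarrow> y \<in> M \<Longrightarrow> x - y \<in> M"
    and diff_closed_minus: "x \<in> M \<Longrightarrow> - x \<in> M"
    and diff_closed_add: "x \<in> M \<Longrightarrow> y \<in> M \<Longrightarrow> x + y \<in> M"
proof -
  show 0: "0 \<in> M" and diff: "x \<in> M \<Longrightarrow> y \<in> M \<Longrightarrow> x - y \<in> M" for x y
    using assms by (auto simp: diff_closed_def)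
  show minus: "x \<in> M \<Longrightarrow> - x \<in> M" for x using diff[OF 0, of x] by simp
  show "x \<in> M \<Longrightarrow> y \<in> M \<Longrightarrow> x + y \<in> M" using diff[of x "- y"] minus by simp
qed

lemma diff_closed_of_int_mult:
  fixes x :: "'a::ring_1"
  assumes M: "diff_closed M" and x: "x \<in> M"
  shows "of_int j * x \<in> M"
proof (induction j rule: int_induct[where k = 0])
  case base then show ?case using diff_closed_0[OF M] by simp
next
  case (step1 i)
  have "x + of_int i * x \<in> M" by (rule diff_closed_add[OF M x step1.IH])
  then show ?case by (simp add: distrib_right add.commute)
next
  case (step2 i)
  have "of_int i * x - x \<in> M" by (rule diff_closed_diff[OF M step2.IH x])
  then show ?case by (simp add: left_diff_distrib)
qed

text \<open>Unit modulus turns negation of the argument into complex conjugation; nontriviality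
  makes the sum over the whole field vanish.\<close>

locale additive_character =
  fixes \<psi> :: "'a::{field,finite} \<Rightarrow> complex"
  assumes add: "\<psi> (x + y) = \<psi> x * \<psi> y"
    and norm_eq_1: "norm (\<psi> x) = 1"
    and nontrivial: "\<exists>x. \<psi> x \<noteq> 1"

text \<open>
  A maximal proper additive subgroup \<open>M\<close> has index \<open>p\<close>, and the character factors through the
  quotient.
\<close>

lemma additive_character_exists:
  assumes p: "prime p" and char: "CHAR('a::{field,finite}) = p"
  obtains \<psi> :: "'a::{field,finite} \<Rightarrow> complex" where "additive_character \<psi>"
proof -
  let ?P = "\<lambda>M :: 'a set. diff_closed M \<and> M \<noteq> UNIV"
  have "?P {0}"
    by (auto simp: diff_closed_def) (metis UNIV_I singletonD zero_neq_one)
  then have "\<exists>M. ?P M \<and> (\<forall>N. ?P N \<longrightarrow> card N \<le> card M)"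
    by (rule ex_has_greatest_nat[where b = "Suc CARD('a)"]) (simp add: card_mono less_Suc_eq_le)
  then obtain M :: "'a set" where M: "diff_closed M" "M \<noteq> UNIV"
    and max: "\<forall>N. ?P N \<longrightarrow> card N \<le> card M"
    by (elim exE conjE) (rule that)
  obtain g where g: "g \<notin> M" using M(2) by auto
  have p0: "of_int (int p) = (0::'a)" using char of_nat_CHAR[where 'a = 'a] by simp
  \<comment> \<open>Otherwise \<open>j\<close> is invertible modulo \<open>p\<close>, and a multiple
    of \<open>j * g\<close> recovers \<open>g\<close> inside \<open>M\<close>.\<close>
  have dvd: "int p dvd j" if "of_int j * g \<in> M" for j
  proof (rule ccontr)
    assume "\<not> int p dvd j"
    then have "coprime j (int p)"
      using prime_imp_coprime[of "int p" j] p by (simp add: coprime_commute)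
    then obtain i where "[j * i = 1] (mod int p)" by (metis cong_solve_coprime_int)
    then have "int p dvd j * i - 1" by (simp add: cong_iff_dvd_diff)
    then obtain t where "j * i - 1 = int p * t" ..
    then have "j * i = int p * t + 1" by simp
    then have "(of_int (j * i) :: 'a) = 1" using p0 by simp
    moreover have "of_int i * (of_int j * g) = of_int (j * i) * g" by (simp add: mult_ac)
    ultimately have "of_int i * (of_int j * g) = g" by simp
    then show False using diff_closed_of_int_mult[OF M(1) that, of i] g by metis
  qed
  \<comment> \<open>\<open>N\<close> is the subgroup generated by \<open>M\<close> and
    \<open>g\<close>; it properly contains \<open>M\<close>, so maximality makes it the whole
    field.\<close>
  define N where "N = {x. \<exists>j. x - of_int j * g \<in> M}"
  have "diff_closed N"
    unfolding diff_closed_def N_def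
  proof (intro conjI ballI)
    show "0 \<in> {x. \<exists>j. x - of_int j * g \<in> M}" using diff_closed_0[OF M(1)] by (auto intro: exI[of _ 0])
    fix x y assume "x \<in> {x. \<exists>j. x - of_int j * g \<in> M}" "y \<in> {x. \<exists>j. x - of_int j * g \<in> M}"
    then obtain i j where "x - of_int i * g \<in> M" "y - of_int j * g \<in> M" by auto
    then have "(x - of_int i * g) - (y - of_int j * g) \<in> M" by (rule diff_closed_diff[OF M(1)])
    then have "(x - y) - of_int (i - j) * g \<in> M" by (simp add: algebra_simps)
    then show "x - y \<in> {x. \<exists>j. x - of_int j * g \<in> M}" by blast
  qed
  moreover have "M \<subseteq> N" by (auto simp: N_def intro: exI[of _ 0])
  moreover have "g \<in> N" using diff_closed_0[OF M(1)] by (auto simp: N_def intro!: exI[of _ 1])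
  ultimately have N_UNIV: "N = UNIV"
    using max g by (metis finite card_seteq)
  \<comment> \<open>On the coset of \<open>j * g\<close> modulo \<open>M\<close> the value is the
    \<open>j\<close>-th power of a primitive \<open>p\<close>-th root of unity. By
    \<open>dvd\<close> the exponent is determined modulo \<open>p\<close>, so the choice does not
    affect the value.\<close>
  define \<psi> where "\<psi> x = cis (2 * pi * of_int (SOME j. x - of_int j * g \<in> M) / p)" for x
  have \<psi>: "\<psi> x = cis (2 * pi * of_int j / p)" if j: "x - of_int j * g \<in> M" for x j
  proof -
    define i where "i = (SOME j. x - of_int j * g \<in> M)"
    have i: "x - of_int i * g \<in> M" unfolding i_def using j by (rule someI)
    have "(x - of_int j * g) - (x - of_int i * g) \<in> M"
      using diff_closed_diff[OF M(1) j i] .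
    then have "of_int (i - j) * g \<in> M" by (simp add: algebra_simps)
    then obtain t where t: "i - j = int p * t" using dvd by blast
    have "real p > 0" using p prime_gt_0_nat by simp
    moreover have "i = j + int p * t" using t by simp
    then have "real_of_int i = of_int j + p * of_int t" by simp
    ultimately have "2 * pi * of_int i / p = 2 * pi * of_int j / p + 2 * pi * of_int t"
      by (simp add: field_simps)
    then have "\<psi> x = cis (2 * pi * of_int j / p) * cis (2 * pi * of_int t)"
      unfolding \<psi>_def i_def[symmetric] cis_mult by (rule arg_cong)
    then show ?thesis by (simp add: cis_multiple_2pi)
  qed
  have "additive_character \<psi>"
  proof
    fix x y :: 'a
    obtain i j where ij: "x - of_int i * g \<in> M" "y - of_int j * g \<in> M" using N_UNIV unfolding N_def by blast
    then have "(x - of_int i * g) + (y - of_int j * g) \<in> M" by (rule diff_closed_add[OF M(1)])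
    then have "(x + y) - of_int (i + j) * g \<in> M" by (simp add: algebra_simps)
    then show "\<psi> (x + y) = \<psi> x * \<psi> y"
      unfolding \<psi>[OF ij(1)] \<psi>[OF ij(2)] cis_mult
      by (subst \<psi>) (assumption, simp add: add_divide_distrib distrib_left)
    show "norm (\<psi> x) = 1" by (simp add: \<psi>_def)
  next
    have "g - of_int 1 * g \<in> M" using diff_closed_0[OF M(1)] by simp
    then have "\<psi> g = cis (2 * pi * of_int 1 / p)" by (rule \<psi>)
    moreover have "cis (2 * pi / p) \<noteq> 1"
    proof
      assume "cis (2 * pi / p) = 1"
      then have "cos (2 * pi / p) = 1" by (simp add: complex_eq_iff)
      then obtain t :: int where "2 * pi / p = of_int t * 2 * pi" using cos_one_2pi_int by blast
      then have "1 = of_int t * real p" using p prime_gt_0_nat by (simp add: field_simps)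
      then have "1 = t * int p" by (metis of_int_1 of_int_eq_iff of_int_mult of_int_of_nat_eq)
      then have "int p dvd 1" by (metis dvd_triv_right)
      then show False using p by (simp add: prime_gt_1_nat nat_dvd_1_iff_1)
    qed
    ultimately have "\<psi> g \<noteq> 1" by simp
    then show "\<exists>x. \<psi> x \<noteq> 1" by blast
  qed
  then show thesis by (rule that)
qed

lemma sum_UNIV_uminus:
  fixes f :: "'a::{finite,group_add} \<Rightarrow> 'b::comm_monoid_add"
  shows "(\<Sum>c\<in>UNIV. f (- c)) = (\<Sum>c\<in>UNIV. f c)"
  by (rule sum.reindex_bij_witness[where i = uminus and j = uminus]) auto

text \<open>Reads the spectrum off the characteristic polynomial of a triangular matrix.\<close>

lemma proots_linear_factors: "proots (\<Prod>a\<leftarrow>as. [:- a, 1:]) = mset as"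
proof (induction as)
  case (Cons a as)
  have "(\<Prod>a\<leftarrow>as. [:- a, 1:]) \<noteq> 0" by (auto simp: prod_list_zero_iff)
  then show ?case using Cons by (simp add: proots_mult del: mult_pCons_left)
qed simp

section \<open>Orthogonality, annihilators and Fourier inversion\<close>

context additive_character
begin

lemma zero [simp]: "\<psi> 0 = 1"
  using add[of 0 0] norm_eq_1[of 0] by auto

lemma minus: "\<psi> (- x) = cnj (\<psi> x)"
proof -
  have "\<psi> (- x) * \<psi> x = 1" using add[of "- x" x] by simp
  moreover have "cnj (\<psi> x) * \<psi> x = 1"
    using complex_norm_square[of "\<psi> x"] norm_eq_1[of x] by (simp add: mult.commute)
  ultimately show ?thesis using norm_eq_1[of x]
    by (metis mult_cancel_right norm_zero zero_neq_one)
qed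

text \<open>The orthogonal complement of \<open>H\<close> for the pairing
  \<open>\<psi> (c * x)\<close>.\<close>

definition annihilator :: "'a set \<Rightarrow> 'a set" where
  "annihilator H = {c. \<forall>x\<in>H. \<psi> (c * x) = 1}"

lemma zero_in_annihilator: "0 \<in> annihilator X"
  by (simp add: annihilator_def)

lemma minus_in_annihilator_iff: "- c \<in> annihilator X \<longleftrightarrow> c \<in> annihilator X"
  by (auto simp: annihilator_def minus)

text \<open>Translation by some \<open>y\<close> in \<open>H\<close> with
  \<open>\<psi> (c * y) \<noteq> 1\<close> permutes the terms but multiplies the sum by
  \<open>\<psi> (c * y)\<close>, so the sum is 0.\<close>

lemma sum_subgroup:
  assumes H: "diff_closed H"
  shows "(\<Sum>x\<in>H. \<psi> (c * x)) = (if c \<in> annihilator H then of_nat (card H) else 0)"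
proof (cases "c \<in> annihilator H")
  case False
  then obtain y where y: "y \<in> H" "\<psi> (c * y) \<noteq> 1" by (auto simp: annihilator_def)
  have "bij_betw ((+) y) H H"
  proof (rule bij_betw_byWitness[where f' = "\<lambda>x. x - y"])
    show "(+) y ` H \<subseteq> H" using diff_closed_add[OF H y(1)] by auto
    show "(\<lambda>x. x - y) ` H \<subseteq> H" using diff_closed_diff[OF H _ y(1)] by auto
  qed auto
  then have "(\<Sum>x\<in>H. \<psi> (c * x)) = (\<Sum>x\<in>H. \<psi> (c * (y + x)))"
    by (rule sum.reindex_bij_betw[symmetric])
  also have "\<dots> = \<psi> (c * y) * (\<Sum>x\<in>H. \<psi> (c * x))"
    by (simp add: add sum_distrib_left distrib_left)
  finally show ?thesis using y False by simp
qed (simp add: annihilator_def)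

lemma sum_UNIV: "(\<Sum>c\<in>UNIV. \<psi> (c * x)) = (if x = 0 then of_nat CARD('a) else 0)"
proof -
  have "x \<in> annihilator UNIV \<longleftrightarrow> x = 0"
  proof
    assume x: "x \<in> annihilator UNIV"
    obtain y where y: "\<psi> y \<noteq> 1" using nontrivial by blast
    show "x = 0"
    proof (rule ccontr)
      assume "x \<noteq> 0"
      then have "\<psi> (x * (y / x)) = \<psi> y" by simp
      moreover have "\<psi> (x * (y / x)) = 1" using x unfolding annihilator_def by blast
      ultimately show False using y by simp
    qed
  qed (simp add: annihilator_def)
  then show ?thesis
    using sum_subgroup[of UNIV x] by (simp add: diff_closed_def mult.commute)
qed

text \<open>Evaluate the double sum of \<open>\<psi> (c * x)\<close> over all \<open>c\<close> and
  over \<open>x\<close> in \<open>H\<close> in both orders, using orthogonality each time.\<close>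

lemma card_annihilator:
  assumes H: "diff_closed H"
  shows "card H * card (annihilator H) = CARD('a)"
proof -
  have "(of_nat (card H * card (annihilator H)) :: complex)
      = (\<Sum>c\<in>UNIV. if c \<in> annihilator H then of_nat (card H) else 0)"
    by (simp add: sum.If_cases)
  also have "\<dots> = (\<Sum>c\<in>UNIV. \<Sum>x\<in>H. \<psi> (c * x))"
    by (simp add: sum_subgroup[OF H])
  also have "\<dots> = (\<Sum>x\<in>H. \<Sum>c\<in>UNIV. \<psi> (c * x))" by (rule sum.swap)
  also have "\<dots> = of_nat CARD('a)"
    using diff_closed_0[OF H] by (simp add: sum_UNIV)
  finally show ?thesis using of_nat_eq_iff by blast
qed

text \<open>The Fourier transform of the indicator function of \<open>R\<close>; a Gaussian period
  when \<open>R\<close> is a multiplicative subgroup.\<close>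

definition period :: "'a set \<Rightarrow> 'a \<Rightarrow> complex" where
  "period R c = (\<Sum>r\<in>R. \<psi> (c * r))"

text \<open>Fourier inversion: after exchanging the sums, orthogonality leaves only the term
  \<open>r = x\<close>.\<close>

lemma period_inversion:
  "(\<Sum>c\<in>UNIV. period R c * \<psi> (- (c * x))) = (if x \<in> R then of_nat CARD('a) else 0)"
proof -
  have "(\<Sum>c\<in>UNIV. period R c * \<psi> (- (c * x))) = (\<Sum>c\<in>UNIV. \<Sum>r\<in>R. \<psi> (c * (r - x)))"
    by (simp add: period_def sum_distrib_right add[symmetric] right_diff_distrib)
  also have "\<dots> = (\<Sum>r\<in>R. \<Sum>c\<in>UNIV. \<psi> (c * (r - x)))" by (rule sum.swap)
  also have "\<dots> = (\<Sum>r\<in>R. if r = x then of_nat CARD('a) else 0)"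
    by (intro sum.cong) (auto simp: sum_UNIV)
  finally show ?thesis by simp
qed

lemma period_minus: "period R (- c) = cnj (period R c)"
  by (simp add: period_def minus)

lemma period_minus_inversion:
  "(\<Sum>c\<in>UNIV. period R (- c) * \<psi> (- (c * x))) = (if - x \<in> R then of_nat CARD('a) else 0)"
  using sum_UNIV_uminus[of "\<lambda>c. period R c * \<psi> (c * x)"] period_inversion[of R "- x"] by simp

text \<open>The characters \<open>x \<mapsto> \<psi> (c x)\<close> are simultaneous eigenvectors of all Cayley digraphs on the
  additive group.\<close>

lemma graph_Spec_gen_paley:
  "graph_Spec (gen_paley k :: ('a, 'a \<times> 'a) pre_digraph)
     = image_mset (period (nonzero_powers k)) (mset_set UNIV)"
proof -
  let ?\<Gamma> = "gen_paley k :: ('a, 'a \<times> 'a) pre_digraph"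
  let ?R = "nonzero_powers k :: 'a set"
  let ?q = "of_nat CARD('a) :: complex"
  obtain vs :: "'a list" where vs: "set vs = UNIV" "distinct vs"
    using finite_distinct_list[of "UNIV :: 'a set"] by auto
  define l where "l = length vs"
  have l: "l = CARD('a)" using vs distinct_card[of vs] by (simp add: l_def)
  have bij: "bij_betw ((!) vs) {..<l} UNIV"
    using bij_betw_nth[OF vs(2) refl refl] vs(1) by (simp add: l_def)
  have nth_eq: "vs ! i = vs ! j \<longleftrightarrow> i = j" if "i < l" "j < l" for i j
    using that vs(2) by (simp add: l_def nth_eq_iff_index_eq)
  have sum_nth: "(\<Sum>i<l. f (vs ! i)) = (\<Sum>c\<in>UNIV. f c)" for f :: "'a \<Rightarrow> complex"
    by (rule sum.reindex_bij_betw[OF bij])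
  have mult: "mat l l f * mat l l g = mat l l (\<lambda>(i, j). \<Sum>h<l. f (i, h) * g (h, j))"
    for f g :: "nat \<times> nat \<Rightarrow> complex"
    by (intro eq_matI) (auto simp: scalar_prod_def atLeast0LessThan)
  define A where "A = adj_matrix_wrt vs ?\<Gamma>"
  \<comment> \<open>\<open>P\<close> is the character table, its columns being the eigenvectors.
    Orthogonality of characters makes \<open>Q\<close> its inverse.\<close>
  define P where "P = mat l l (\<lambda>(i, j). \<psi> (vs ! j * vs ! i))"
  define Q where "Q = mat l l (\<lambda>(i, j). \<psi> (- (vs ! i * vs ! j)) / ?q)"
  define D where "D = mat l l (\<lambda>(i, j). if i = j then period ?R (vs ! i) else 0)"
  have carr: "A \<in> carrier_mat l l" "D \<in> carrier_mat l l" "P \<in> carrier_mat l l" "Q \<in> carrier_mat l l"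
    by (auto simp: A_def P_def Q_def D_def adj_matrix_wrt_def l_def)
  have PQ: "P * Q = 1\<^sub>m l"
  proof (intro eq_matI)
    fix i j assume "i < dim_row (1\<^sub>m l :: complex mat)" "j < dim_col (1\<^sub>m l :: complex mat)"
    then have ij: "i < l" "j < l" by auto
    have "(P * Q) $$ (i, j) = (\<Sum>h<l. \<psi> (vs ! h * (vs ! i - vs ! j)) / ?q)"
      using ij unfolding P_def Q_def mult
      by (simp add: add[symmetric] right_diff_distrib)
    also have "\<dots> = (\<Sum>c\<in>UNIV. \<psi> (c * (vs ! i - vs ! j))) / ?q"
      by (simp add: sum_nth[of "\<lambda>c. \<psi> (c * (vs ! i - vs ! j)) / ?q"] sum_divide_distrib)
    also have "\<dots> = 1\<^sub>m l $$ (i, j)"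
      using ij nth_eq by (simp add: sum_UNIV)
    finally show "(P * Q) $$ (i, j) = 1\<^sub>m l $$ (i, j)" .
  qed (simp_all add: P_def Q_def)
  have QP: "Q * P = 1\<^sub>m l"
    by (rule mat_mult_left_right_inverse[OF carr(3,4) PQ])
  have PD: "P * D = mat l l (\<lambda>(i, j). \<psi> (vs ! j * vs ! i) * period ?R (vs ! j))"
    unfolding P_def D_def mult by (intro eq_matI) (auto simp: if_distrib[of "(*) _"] sum.delta cong: if_cong)
  have APDQ: "A = P * D * Q"
  proof (intro eq_matI)
    fix i j assume "i < dim_row (P * D * Q)" "j < dim_col (P * D * Q)"
    then have ij: "i < l" "j < l" using carr by auto
    let ?x = "vs ! i" and ?y = "vs ! j"
    \<comment> \<open>The entry is Fourier inversion at the difference of the two vertices, hence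
      the indicator of an arc.\<close>
    have "(P * D * Q) $$ (i, j) = (\<Sum>h<l. period ?R (vs ! h) * \<psi> (- (vs ! h * (?y - ?x))) / ?q)"
      using ij unfolding PD Q_def mult
      by (auto intro!: sum.cong simp: add[symmetric] algebra_simps)
    also have "\<dots> = (\<Sum>c\<in>UNIV. period ?R c * \<psi> (- (c * (?y - ?x)))) / ?q"
      by (simp add: sum_nth[of "\<lambda>c. period ?R c * \<psi> (- (c * (?y - ?x))) / ?q"] sum_divide_distrib)
    also have "\<dots> = A $$ (i, j)"
      using ij by (simp add: period_inversion A_def adj_matrix_wrt_def l_def arcs_ends_gen_paley)
    finally show "A $$ (i, j) = (P * D * Q) $$ (i, j)" by simp
  qed (use carr in auto)
  have "char_poly (adj_matrix ?\<Gamma>) = char_poly A"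
    unfolding A_def using vs by (intro char_poly_adj_matrix_wrt[symmetric]) (auto simp: gen_paley_def)
  also have "\<dots> = char_poly D"
    by (rule char_poly_similar, rule similar_matI[OF _ PQ QP APDQ]) (use carr in auto)
  also have "\<dots> = (\<Prod>a\<leftarrow>diag_mat D. [:- a, 1:])"
    by (rule char_poly_upper_triangular[OF carr(2)]) (auto simp: D_def)
  finally have "graph_Spec ?\<Gamma> = mset (diag_mat D)"
    unfolding graph_Spec_def by (simp add: proots_linear_factors)
  also have "diag_mat D = map (period ?R) vs"
    by (auto simp: diag_mat_def D_def l_def intro: nth_equalityI)
  also have "mset \<dots> = image_mset (period ?R) (mset_set UNIV)"
    using mset_set_set[OF vs(2)] vs(1) by simp
  finally show ?thesis .
qed

end

section \<open>The subring generated by an element\<close>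

text \<open>The ring Z[w]. Integer coefficients allow the same polynomial to be evaluated in two
  different fields when an isomorphism is built.\<close>

definition int_adjoin :: "'a::comm_ring_1 \<Rightarrow> 'a set" where
  "int_adjoin w = range (\<lambda>P. poly (of_int_poly P) w)"

lemma diff_closed_int_adjoin: "diff_closed (int_adjoin w)"
  unfolding diff_closed_def
proof (intro conjI ballI)
  show "0 \<in> int_adjoin w"
    unfolding int_adjoin_def by (rule range_eqI[of _ _ 0]) simp
  fix x y assume "x \<in> int_adjoin w" "y \<in> int_adjoin w"
  then obtain P Q where "x = poly (of_int_poly P) w" "y = poly (of_int_poly Q) w"
    by (auto simp: int_adjoin_def)
  then have "x - y = poly (of_int_poly (P - Q)) w"
    by (simp add: of_int_poly_hom.hom_minus)
  then show "x - y \<in> int_adjoin w" by (auto simp: int_adjoin_def)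
qed

lemma int_adjoin_mult:
  assumes "x \<in> int_adjoin w" "y \<in> int_adjoin w"
  shows "x * y \<in> int_adjoin w"
proof -
  obtain P Q where "x = poly (of_int_poly P) w" "y = poly (of_int_poly Q) w"
    using assms by (auto simp: int_adjoin_def)
  then have "x * y = poly (of_int_poly (P * Q)) w"
    by (simp add: of_int_poly_hom.hom_mult)
  then show ?thesis by (auto simp: int_adjoin_def)
qed

lemma int_adjoin_power: "w ^ i \<in> int_adjoin w"
  unfolding int_adjoin_def
  by (rule range_eqI[of _ _ "monom 1 i"]) (simp add: poly_monom)

text \<open>Additively, Z[w] is spanned by the powers of \<open>w\<close>.\<close>

lemma int_adjoin_subset:
  assumes M: "diff_closed M" and w: "\<And>i. w ^ i \<in> M"
  shows "int_adjoin w \<subseteq> M"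
proof
  fix x assume "x \<in> int_adjoin w"
  then obtain P where x: "x = poly (of_int_poly P) w" by (auto simp: int_adjoin_def)
  have sum: "(\<Sum>i\<in>I. f i) \<in> M" if "finite I" "\<And>i. i \<in> I \<Longrightarrow> f i \<in> M" for I and f :: "nat \<Rightarrow> 'a"
    using that by (induction I rule: finite_induct) (auto simp: diff_closed_0[OF M] diff_closed_add[OF M])
  show "x \<in> M"
    unfolding x poly_altdef by (rule sum) (auto intro: diff_closed_of_int_mult[OF M w])
qed

text \<open>The cardinality is some \<open>p ^ d\<close>. Since \<open>w\<close> has order
  \<open>n\<close> and acts on the nonzero elements, \<open>ord n p\<close> divides
  \<open>d\<close>. Conversely the subring lies in the fixed points of the Frobenius power
  \<open>x ^ h\<close> with \<open>h = p ^ ord n p\<close>, which are roots of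
  \<open>X^h - X\<close>.\<close>

lemma card_int_adjoin:
  fixes w :: "'a::{field,finite}"
  assumes p: "prime p" and card: "CARD('a) = p ^ m" and w: "w \<noteq> 0"
    and ord_w: "\<And>i. w ^ i = 1 \<longleftrightarrow> n dvd i"
  shows "card (int_adjoin w) = p ^ ord n p"
proof -
  let ?H = "int_adjoin w"
  have char: "CHAR('a) = p" by (rule CHAR_finite_field[OF p card])
  then obtain \<psi> :: "'a \<Rightarrow> complex" where "additive_character \<psi>"
    by (rule additive_character_exists[OF p])
  then interpret additive_character \<psi> .
  have H: "diff_closed ?H" by (rule diff_closed_int_adjoin)
  have "card ?H dvd p ^ m" using card_annihilator[OF H] card by (metis dvd_triv_left)
  then obtain d where d: "card ?H = p ^ d" using p by (auto simp: divides_primepow_nat)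
  have p1: "p > 1" using p by (rule prime_gt_1_nat)
  have cong_iff: "[p ^ i = 1] (mod n) \<longleftrightarrow> w ^ (p ^ i - 1) = 1" for i
    using p1 by (simp add: ord_w cong_altdef_nat)
  have "{0, 1} \<subseteq> ?H" using diff_closed_0[OF H] int_adjoin_power[of w 0] by simp
  then have "card {0, 1 :: 'a} \<le> p ^ d" unfolding d[symmetric] by (intro card_mono) auto
  then have "d > 0" by (intro gr0I) auto
  have "w ^ card (?H - {0}) = 1"
    by (rule power_card_eq_1) (use w int_adjoin_mult[OF int_adjoin_power[of w 1]] in auto)
  then have "w ^ (p ^ d - 1) = 1" using diff_closed_0[OF H] d by (simp add: card_Diff_singleton)
  then have "ord n p dvd d" using cong_iff ord_divides by blast
  then have le: "ord n p \<le> d" using \<open>d > 0\<close> by (simp add: dvd_imp_le)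
  have pos: "ord n p > 0" using \<open>ord n p dvd d\<close> \<open>d > 0\<close> by (auto intro!: gr0I simp del: ord_gt_0_iff)
  define h where "h = p ^ ord n p"
  have h: "h > 1" using p1 pos unfolding h_def by (intro one_less_power)
  have frob: "(x + y) ^ h = x ^ h + y ^ h" for x y :: 'a
    unfolding h_def using p char by (intro freshmans_dream') auto
  let ?K = "{x :: 'a. x ^ h = x}"
  have "diff_closed ?K"
    unfolding diff_closed_def
  proof (intro conjI ballI)
    show "0 \<in> ?K" using h by simp
    fix x y assume xy: "x \<in> ?K" "y \<in> ?K"
    \<comment> \<open>Additivity applied to \<open>(x - y) + y\<close> avoids any discussion of the
      sign of \<open>(- y) ^ h\<close>.\<close>
    have "x ^ h = (x - y) ^ h + y ^ h" using frob[of "x - y" y] by simp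
    then show "x - y \<in> ?K" using xy by (simp add: algebra_simps)
  qed
  moreover have "w ^ (h - 1) = 1" using cong_iff ord unfolding h_def by blast
  then have "w ^ h = w" using h power_minus_mult[of h w] by simp
  then have "w ^ i \<in> ?K" for i by (simp add: power_mult[symmetric] mult.commute[of i h]) (simp add: power_mult)
  ultimately have "?H \<subseteq> ?K" by (rule int_adjoin_subset)
  then have "card ?H \<le> card ?K" by (intro card_mono) auto
  also have "\<dots> \<le> h"
  proof -
    let ?P = "monom 1 h - monom 1 1 :: 'a poly"
    have "coeff ?P h = 1" using h by simp
    then have "?P \<noteq> 0" by (metis coeff_0 zero_neq_one)
    then have "card {x. poly ?P x = 0} \<le> degree ?P" by (rule card_poly_roots_bound)
    also have "degree ?P \<le> h"
      using h by (intro degree_diff_le) (auto intro: order_trans[OF degree_monom_le])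
    finally show ?thesis by (simp add: poly_monom)
  qed
  finally have "p ^ d \<le> p ^ ord n p" unfolding d h_def .
  then show ?thesis using d le p1 by (simp add: power_increasing antisym)
qed

section \<open>Periods of a cyclic group of odd order\<close>

locale odd_cyclic_subgroup = additive_character \<psi> for \<psi> :: "'a::{field,finite} \<Rightarrow> complex" +
  fixes w :: 'a and n :: nat
  assumes w_nonzero: "w \<noteq> 0"
    and power_w_eq_1_iff: "w ^ i = 1 \<longleftrightarrow> n dvd i"
    and odd_n: "odd n"
    and minus_1_neq_1: "(- 1 :: 'a) \<noteq> 1"
begin

section \<open>The cyclic group \<open>R\<close> inside its additive span \<open>H\<close>\<close>

definition R :: "'a set" where "R = range (\<lambda>i. w ^ i)"

abbreviation H :: "'a set" where "H \<equiv> int_adjoin w"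

lemma one_in_R: "1 \<in> R"
  unfolding R_def by (rule range_eqI[of _ _ 0]) simp

lemma zero_notin_R: "0 \<notin> R"
  using w_nonzero by (auto simp: R_def)

lemma R_mult: "x \<in> R \<Longrightarrow> y \<in> R \<Longrightarrow> x * y \<in> R"
  by (auto simp: R_def power_add[symmetric])

lemma R_inverse:
  assumes "x \<in> R"
  shows "inverse x \<in> R"
proof -
  obtain i where x: "x = w ^ i" using assms by (auto simp: R_def)
  have "n > 0" using odd_n by (auto intro: gr0I)
  then have "i * n = i + i * (n - 1)" by (cases n) auto
  then have "x * w ^ (i * (n - 1)) = w ^ (i * n)" by (simp add: x power_add)
  also have "\<dots> = 1" by (simp add: power_w_eq_1_iff)
  finally have "inverse x = w ^ (i * (n - 1))" by (metis inverse_unique)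
  then show ?thesis by (auto simp: R_def)
qed

lemma R_subset_H: "R \<subseteq> H"
  using int_adjoin_power by (auto simp: R_def)

lemma card_R: "card R = n"
proof -
  have n: "n > 0" using odd_n by (auto intro: gr0I)
  have pow_mod: "w ^ i = w ^ (i mod n)" for i
  proof -
    have "w ^ (n * (i div n)) = 1" by (simp add: power_w_eq_1_iff)
    then show ?thesis by (metis mult_1 mult_div_mod_eq power_add)
  qed
  have le: "i = j" if "i \<le> j" "j < n" "w ^ i = w ^ j" for i j
  proof -
    have "w ^ j = w ^ i * w ^ (j - i)" using that(1) by (simp add: power_add[symmetric])
    then have "w ^ (j - i) = 1" using that w_nonzero by simp
    then have "n dvd j - i" by (simp add: power_w_eq_1_iff)
    then show ?thesis using that nat_dvd_not_less[of "j - i" n] by (cases "i = j") auto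
  qed
  then have inj: "inj_on (\<lambda>i. w ^ i) {..<n}"
    by (intro inj_onI) (metis lessThan_iff nat_le_linear)
  have "R = (\<lambda>i. w ^ i) ` {..<n}"
  proof
    show "R \<subseteq> (\<lambda>i. w ^ i) ` {..<n}"
      using pow_mod n unfolding R_def by (metis image_subset_iff imageI lessThan_iff mod_less_divisor)
  qed (auto simp: R_def)
  then show ?thesis using card_image[OF inj] by simp
qed

text \<open>The element -1 has order 2, which does not divide the odd order
  \<open>n\<close>.\<close>

lemma minus_one_notin_R: "- 1 \<notin> R"
proof
  assume "- 1 \<in> R"
  then obtain i where i: "w ^ i = - 1" by (auto simp: R_def)
  then have "w ^ (i * 2) = 1" by (simp add: power_mult)
  then have "n dvd i * 2" by (simp add: power_w_eq_1_iff)
  then have "n dvd i" using odd_n by (simp add: coprime_dvd_mult_left_iff)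
  then show False using i minus_1_neq_1 by (simp add: power_w_eq_1_iff[symmetric])
qed

lemma minus_notin_R:
  assumes "x \<in> R"
  shows "- x \<notin> R"
proof
  assume "- x \<in> R"
  then have "- x * inverse x \<in> R" using R_inverse[OF assms] R_mult by blast
  moreover have "x \<noteq> 0" using assms zero_notin_R by auto
  ultimately show False using minus_one_notin_R by simp
qed

lemma R_Un_minus_R_subset: "R \<union> uminus ` R \<subseteq> H - {0}"
proof -
  have "- r \<in> H" if "r \<in> R" for r
    using that R_subset_H diff_closed_minus[OF diff_closed_int_adjoin] by blast
  moreover have "r \<noteq> 0" if "r \<in> R" for r using that zero_notin_R by blast
  ultimately show ?thesis using R_subset_H by auto
qed

section \<open>The number of distinct periods\<close>

lemma period_annihilator:
  assumes "c \<in> annihilator H"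
  shows "period R c = of_nat n"
proof -
  have "period R c = (\<Sum>r\<in>R. 1)"
    unfolding period_def by (rule sum.cong) (use assms R_subset_H in \<open>auto simp: annihilator_def\<close>)
  then show ?thesis by (simp add: card_R)
qed

lemma period_0: "period R 0 = of_nat n"
  by (rule period_annihilator[OF zero_in_annihilator])

text \<open>Equality holds in the triangle inequality for a sum of unit vectors only if they agree.\<close>

lemma period_eq_n_iff: "period R c = of_nat n \<longleftrightarrow> c \<in> annihilator H"
proof
  assume eq: "period R c = of_nat n"
  have Re_le: "Re (\<psi> x) \<le> 1" for x using complex_Re_le_cmod[of "\<psi> x"] norm_eq_1 by simp
  \<comment> \<open>Nonnegative terms with sum 0 all vanish.\<close>
  have "(\<Sum>r\<in>R. 1 - Re (\<psi> (c * r))) = 0"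
    using arg_cong[OF eq, of Re] by (simp add: period_def sum_subtractf card_R)
  then have Re: "Re (\<psi> (c * r)) = 1" if "r \<in> R" for r
    using that Re_le by (subst (asm) sum_nonneg_eq_0_iff) (auto simp: algebra_simps)
  have "\<psi> (c * r) = 1" if "r \<in> R" for r
    using Re[OF that] norm_eq_1[of "c * r"] by (simp add: complex_eq_iff cmod_def)
  \<comment> \<open>The kernel of \<open>x \<mapsto> \<psi> (c * x)\<close> is an additive subgroup,
    so containing \<open>R\<close> it contains the span \<open>H\<close>.\<close>
  moreover have "diff_closed {x. \<psi> (c * x) = 1}"
    unfolding diff_closed_def by (auto simp: right_diff_distrib add[of _ "- _", simplified] minus)
  ultimately have "H \<subseteq> {x. \<psi> (c * x) = 1}"
    by (intro int_adjoin_subset) (auto simp: R_def)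
  then show "c \<in> annihilator H" by (auto simp: annihilator_def)
qed (rule period_annihilator)

text \<open>If all periods were real they would be even in \<open>c\<close>, and inversion would
  give the indicator of \<open>R\<close> the same value at 1 and -1.\<close>

lemma period_not_real: obtains c where "Im (period R c) \<noteq> 0"
proof (rule ccontr)
  assume "\<not> thesis"
  then have "period R (- c) = period R c" for c
    using that by (auto simp: period_minus complex_eq_iff)
  then have "(if - 1 \<in> R then of_nat CARD('a) else 0) = (if 1 \<in> R then of_nat CARD('a) else 0 :: complex)"
    using period_minus_inversion[of R 1] period_inversion[of R 1] by simp
  then show False using one_in_R minus_one_notin_R by simp
qed

lemma three_periods:
  obtains l where "card {of_nat n, l, cnj l} = 3" "{of_nat n, l, cnj l} \<subseteq> range (period R)"
proof -
  obtain c where c: "Im (period R c) \<noteq> 0" by (rule period_not_real)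
  show thesis
  proof
    show "card {of_nat n, period R c, cnj (period R c)} = 3"
      using c by (auto simp: card_insert_if complex_eq_iff)
    show "{of_nat n, period R c, cnj (period R c)} \<subseteq> range (period R)"
      using period_0[symmetric] period_minus[of R c, symmetric] by auto
  qed
qed

lemma card_range_period_ge_3: "card (range (period R)) \<ge> 3"
proof -
  obtain l where l: "card {of_nat n, l, cnj l} = 3" "{of_nat n, l, cnj l} \<subseteq> range (period R)"
    by (rule three_periods)
  show ?thesis using card_mono[OF _ l(2)] l(1) by simp
qed

text \<open>The sum of the indicators of \<open>R\<close> and of \<open>- R\<close> is the inverse
  transform of \<open>period R c + period R (- c)\<close>, a constant plus a multiple of the
  indicator of the annihilator. The constant contributes only at 0, and the rest is constant on
  \<open>H\<close>.\<close>

lemma three_periods_imp: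
  assumes three: "card (range (period R)) = 3"
  shows "H - {0} = R \<union> uminus ` R"
proof -
  let ?q = "of_nat CARD('a) :: complex" and ?A = "annihilator H"
  obtain l where l: "card {of_nat n, l, cnj l} = 3" "{of_nat n, l, cnj l} \<subseteq> range (period R)"
    by (rule three_periods)
  then have range: "range (period R) = {of_nat n, l, cnj l}"
    using three by (metis card_subset_eq finite finite_imageI)
  let ?s = "l + cnj l"
  have sum_eq: "period R c + period R (- c) = ?s + (if c \<in> ?A then 2 * of_nat n - ?s else 0)" for c
  proof (cases "c \<in> ?A")
    case True
    then show ?thesis by (simp add: period_annihilator minus_in_annihilator_iff)
  next
    case False
    then have "period R c \<noteq> of_nat n" by (simp add: period_eq_n_iff)
    then have "period R c = l \<or> period R c = cnj l" using range by blast
    then show ?thesis using False by (auto simp: period_minus)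
  qed
  have key: "?q * ((if x \<in> R then 1 else 0) + (if - x \<in> R then 1 else 0))
      = (2 * of_nat n - ?s) * of_nat (card ?A)" if "x \<in> H" "x \<noteq> 0" for x
  proof -
    have "?q * ((if x \<in> R then 1 else 0) + (if - x \<in> R then 1 else 0))
        = (\<Sum>c\<in>UNIV. (period R c + period R (- c)) * \<psi> (- (c * x)))"
      by (simp add: distrib_right sum.distrib period_inversion period_minus_inversion)
    also have "\<dots> = (\<Sum>c\<in>UNIV. ?s * \<psi> (c * - x)
        + (if c \<in> ?A then (2 * of_nat n - ?s) * \<psi> (- (c * x)) else 0))"
      unfolding sum_eq by (intro sum.cong) (auto simp: distrib_right)
    also have "\<dots> = ?s * (\<Sum>c\<in>UNIV. \<psi> (c * - x)) + (\<Sum>c\<in>?A. (2 * of_nat n - ?s) * \<psi> (- (c * x)))"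
      by (simp only: sum.distrib sum_distrib_left) (simp add: sum.If_cases)
    also have "(\<Sum>c\<in>?A. (2 * of_nat n - ?s) * \<psi> (- (c * x))) = (\<Sum>c\<in>?A. 2 * of_nat n - ?s)"
      by (rule sum.cong) (use that in \<open>auto simp: annihilator_def minus\<close>)
    finally show ?thesis using that by (simp add: sum_UNIV mult.commute del: mult_minus_right)
  qed
  have "1 \<in> H" using one_in_R R_subset_H by auto
  \<comment> \<open>The constant is calibrated at 1, which lies in \<open>R\<close> while -1 does
    not.\<close>
  then have q: "(2 * of_nat n - ?s) * of_nat (card ?A) = ?q"
    using key[of 1] one_in_R minus_one_notin_R by simp
  show ?thesis
  proof
    show "H - {0} \<subseteq> R \<union> uminus ` R"
    proof
      fix x assume "x \<in> H - {0}"
      then have "?q * ((if x \<in> R then 1 else 0) + (if - x \<in> R then 1 else 0)) = ?q"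
        using key q by simp
      then have "x \<in> R \<or> - x \<in> R" by (auto split: if_splits)
      then show "x \<in> R \<union> uminus ` R" by (auto simp: image_iff) (metis minus_minus)
    qed
  qed (rule R_Un_minus_R_subset)
qed

section \<open>The case in which \<open>R\<close> and \<open>- R\<close> fill the nonzero part of
  \<open>H\<close>\<close>

lemma card_R_Un_minus_R: "card (R \<union> uminus ` R) = 2 * n"
proof -
  have "R \<inter> uminus ` R = {}" using minus_notin_R by auto
  then show ?thesis by (simp add: card_Un_disjoint card_image card_R)
qed

text \<open>One inclusion always holds, so equality of the finite sets is a matter of
  counting.\<close>

lemma H_eq_iff_card: "H - {0} = R \<union> uminus ` R \<longleftrightarrow> card H = 2 * n + 1"
proof -
  have "0 \<in> H" by (rule diff_closed_0[OF diff_closed_int_adjoin])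
  then have card: "card H = card (H - {0}) + 1" using card_Suc_Diff1[of H 0] by simp
  have "R \<union> uminus ` R = H - {0}" if "card (H - {0}) = 2 * n"
    by (rule card_subset_eq[OF _ R_Un_minus_R_subset]) (simp_all add: that card_R_Un_minus_R)
  then show ?thesis using card card_R_Un_minus_R by auto
qed

text \<open>
  Expanding \<open>\<bar>period R c\<bar>\<^sup>2\<close> gives a sum of \<open>n\<close> periods, exactly one of which is trivial, so
  comparing real parts determines the absolute value.
\<close>

lemma period_off_annihilator:
  assumes half: "H - {0} = R \<union> uminus ` R" and c: "c \<notin> annihilator H"
  shows "Re (period R c) = - 1 / 2" and "(Im (period R c))\<^sup>2 = real (card H) / 4"
proof -
  have H: "diff_closed H" by (rule diff_closed_int_adjoin)
  \<comment> \<open>The vanishing sum over \<open>H\<close> splits into the parts over 0,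
    \<open>R\<close> and \<open>- R\<close>. General \<open>c\<close> is required, since the result
    is used below at \<open>c * (t - 1)\<close>.\<close>
  have Re: "Re (period R c) = - 1 / 2" if c: "c \<notin> annihilator H" for c
  proof -
    have "(\<Sum>x\<in>H. \<psi> (c * x)) = \<psi> (c * 0) + (\<Sum>x\<in>H - {0}. \<psi> (c * x))"
      by (rule sum.remove) (simp_all add: diff_closed_0[OF H])
    also have "(\<Sum>x\<in>H - {0}. \<psi> (c * x)) = (\<Sum>x\<in>R. \<psi> (c * x)) + (\<Sum>x\<in>uminus ` R. \<psi> (c * x))"
      unfolding half by (rule sum.union_disjoint) (use minus_notin_R in auto)
    also have "(\<Sum>x\<in>uminus ` R. \<psi> (c * x)) = (\<Sum>x\<in>R. \<psi> (- c * x))"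
      by (subst sum.reindex) auto
    finally have "1 + (period R c + period R (- c)) = 0"
      using c by (simp add: sum_subgroup[OF H] period_def)
    then have "Re (1 + (period R c + period R (- c))) = 0" by simp
    then show ?thesis by (simp add: period_minus)
  qed
  from Re[OF c] show Re_c: "Re (period R c) = - 1 / 2" .
  \<comment> \<open>In the present case \<open>t - 1\<close> has its inverse in \<open>H\<close>, so
    if \<open>c * (t - 1)\<close> annihilated \<open>H\<close>, then so would
    \<open>c\<close>.\<close>
  have off: "c * (t - 1) \<notin> annihilator H" if t: "t \<in> R" "t \<noteq> 1" for t
  proof
    assume asm: "c * (t - 1) \<in> annihilator H"
    have "t - 1 \<in> H - {0}"
      using t one_in_R R_subset_H diff_closed_diff[OF H] by auto
    then have u: "t - 1 \<noteq> 0" and "t - 1 \<in> R \<union> uminus ` R" unfolding half[symmetric] by auto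
    then have "t - 1 \<in> R \<or> - (t - 1) \<in> R" by (metis UnE imageE minus_minus)
    with R_inverse have "inverse (t - 1) \<in> R \<or> - inverse (t - 1) \<in> R"
      by (metis inverse_minus_eq)
    then have "inverse (t - 1) \<in> H"
      using R_subset_H diff_closed_minus[OF H] by (metis minus_minus subsetD)
    then have "\<psi> (c * (t - 1) * (inverse (t - 1) * x)) = 1" if "x \<in> H" for x
      using asm that int_adjoin_mult unfolding annihilator_def by blast
    moreover have "c * (t - 1) * (inverse (t - 1) * x) = c * x" for x using u by simp
    ultimately have "c \<in> annihilator H" by (simp add: annihilator_def)
    with c show False ..
  qed
  have bij: "bij_betw (\<lambda>t. t * s) R R" if "s \<in> R" for s
  proof (rule bij_betw_byWitness[where f' = "\<lambda>t. t * inverse s"])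
    have "s \<noteq> 0" using that zero_notin_R by auto
    then show "\<forall>a\<in>R. a * s * inverse s = a" "\<forall>a\<in>R. a * inverse s * s = a" by auto
    show "(\<lambda>t. t * s) ` R \<subseteq> R" "(\<lambda>t. t * inverse s) ` R \<subseteq> R"
      using that R_mult R_inverse by auto
  qed
  have "cnj (period R c) * period R c = (\<Sum>s\<in>R. \<Sum>r\<in>R. \<psi> (c * (r - s)))"
    unfolding period_minus[symmetric]
    by (simp add: period_def sum_product add[symmetric] right_diff_distrib)
  \<comment> \<open>The substitution \<open>r = t * s\<close> makes the inner sum over
    \<open>s\<close> a period at \<open>c * (t - 1)\<close>.\<close>
  also have "\<dots> = (\<Sum>s\<in>R. \<Sum>t\<in>R. \<psi> (c * (t * s - s)))"
    by (intro sum.cong refl sum.reindex_bij_betw[OF bij, symmetric])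
  also have "\<dots> = (\<Sum>t\<in>R. \<Sum>s\<in>R. \<psi> (c * (t * s - s)))" by (rule sum.swap)
  also have "\<dots> = (\<Sum>t\<in>R. period R (c * (t - 1)))"
    by (simp add: period_def algebra_simps)
  also have "\<dots> = period R (c * (1 - 1)) + (\<Sum>t\<in>R - {1}. period R (c * (t - 1)))"
    by (rule sum.remove) (simp_all add: one_in_R)
  finally have "Re (cnj (period R c) * period R c) = n + (\<Sum>t\<in>R - {1}. Re (period R (c * (t - 1))))"
    by (simp add: period_0)
  also have "(\<Sum>t\<in>R - {1}. Re (period R (c * (t - 1)))) = (\<Sum>t\<in>R - {1}. - 1 / 2)"
    by (intro sum.cong) (auto simp: Re off)
  also have "\<dots> = - (real n - 1) / 2"
  proof -
    have "n \<ge> 1" using odd_n by (cases n) auto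
    then show ?thesis using one_in_R by (simp add: card_R card_Diff_singleton of_nat_diff field_simps)
  qed
  \<comment> \<open>Removing the squared real part 1/4 leaves (2n + 1)/4 for the squared imaginary
    part.\<close>
  finally have "(Re (period R c))\<^sup>2 + (Im (period R c))\<^sup>2 = (real n + 1) / 2"
    by (simp add: power2_eq_square field_simps)
  moreover have "card H = 2 * n + 1" using half H_eq_iff_card by simp
  ultimately show "(Im (period R c))\<^sup>2 = real (card H) / 4"
    unfolding Re_c by (simp add: power2_eq_square field_simps)
qed

text \<open>Negation of \<open>c\<close> conjugates the period, so the two nonreal values occur
  equally often. Their multiplicity then follows from \<open>card H * card A = CARD('a)\<close> and
  \<open>card H = 2 * n + 1\<close>.\<close>

lemma image_mset_period:
  assumes half: "H - {0} = R \<union> uminus ` R"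
  defines "A \<equiv> annihilator H"
  shows "image_mset (period R) (mset_set UNIV) =
    replicate_mset (card A) (of_nat n)
    + replicate_mset (n * card A) ((- 1 + \<i> * of_real (sqrt (card H))) / 2)
    + replicate_mset (n * card A) ((- 1 - \<i> * of_real (sqrt (card H))) / 2)"
proof -
  let ?h = "sqrt (card H)"
  define P where "P = {c. c \<notin> A \<and> Im (period R c) > 0}"
  define N where "N = {c. c \<notin> A \<and> Im (period R c) < 0}"
  have card_H: "card H = 2 * n + 1" using half H_eq_iff_card by simp
  then have h: "?h > 0" by simp
  have Im: "Im (period R c) = ?h / 2 \<or> Im (period R c) = - (?h / 2)" if "c \<notin> A" for c
  proof -
    have "(Im (period R c))\<^sup>2 = (?h / 2)\<^sup>2"
      using period_off_annihilator(2)[OF half] that by (simp add: A_def power_divide)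
    then show ?thesis by (simp only: power2_eq_iff)
  qed
  have UNIV: "UNIV = A \<union> (P \<union> N)" 
  proof (intro UNIV_eq_I)
    fix c show "c \<in> A \<union> (P \<union> N)"
    proof (cases "c \<in> A")
      case False
      then have "Im (period R c) > 0 \<or> Im (period R c) < 0" using Im[of c] h by linarith
      with False show ?thesis by (simp add: P_def N_def)
    qed simp
  qed
  have disj: "A \<inter> (P \<union> N) = {}" "P \<inter> N = {}" by (auto simp: P_def N_def)
  have P: "period R c = (- 1 + \<i> * of_real ?h) / 2" if "c \<in> P" for c
    using that Im[of c] period_off_annihilator(1)[OF half, of c] h
    by (auto simp: P_def A_def complex_eq_iff)
  have N: "period R c = (- 1 - \<i> * of_real ?h) / 2" if "c \<in> N" for c
    using that Im[of c] period_off_annihilator(1)[OF half, of c] h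
    by (auto simp: N_def A_def complex_eq_iff)
  have "N = uminus ` P"
  proof
    show "uminus ` P \<subseteq> N"
      by (auto simp: P_def N_def A_def minus_in_annihilator_iff period_minus)
    have "- c \<in> P" if "c \<in> N" for c
      using that by (auto simp: P_def N_def A_def minus_in_annihilator_iff period_minus)
    then show "N \<subseteq> uminus ` P" by (metis image_eqI minus_minus subsetI)
  qed
  then have NP: "card N = card P" by (simp add: card_image)
  have "card H * card A = card A + (card P + card N)"
    using card_annihilator[OF diff_closed_int_adjoin, of w] disj
    unfolding UNIV A_def[symmetric] by (simp add: card_Un_disjoint)
  then have card_P: "card P = n * card A" using NP card_H by simp
  have const: "image_mset f (mset_set X) = replicate_mset (card X) z"
    if "\<And>x. x \<in> X \<Longrightarrow> f x = z" for f :: "'a \<Rightarrow> complex" and X z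
  proof -
    have "image_mset f (mset_set X) = image_mset (\<lambda>_. z) (mset_set X)"
      by (rule image_mset_cong) (simp add: that)
    then show ?thesis by (simp add: image_mset_const_eq)
  qed
  have "mset_set (UNIV :: 'a set) = mset_set A + (mset_set P + mset_set N)"
    using disj unfolding UNIV by (simp add: mset_set_Union)
  then show ?thesis
    using const[of A "period R"] const[of P "period R", OF P] const[of N "period R", OF N]
    by (simp add: A_def period_annihilator card_P NP)
qed

text \<open>With \<open>n = 2 * j + 1\<close>, the number \<open>j + 1\<close> is an inverse of 2
  modulo \<open>n\<close>, which yields square roots inside \<open>R\<close>. Conversely, squaring
  removes the sign of an element of \<open>- R\<close>.\<close>

lemma R_iff_square:
  assumes half: "H - {0} = R \<union> uminus ` R"
  shows "x \<in> R \<longleftrightarrow> (\<exists>y\<in>H - {0}. x = y\<^sup>2)"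
proof
  assume "x \<in> R"
  then obtain i where i: "x = w ^ i" by (auto simp: R_def)
  obtain j where j: "n = 2 * j + 1" using odd_n by (rule oddE)
  have "(w ^ (i * (j + 1)))\<^sup>2 = w ^ i * w ^ (i * n)"
    by (simp add: j power_mult[symmetric] power_add[symmetric] algebra_simps)
  also have "w ^ (i * n) = 1" by (simp add: power_w_eq_1_iff)
  finally have "x = (w ^ (i * (j + 1)))\<^sup>2" by (simp add: i)
  moreover have "w ^ (i * (j + 1)) \<in> H - {0}" using int_adjoin_power w_nonzero by simp
  ultimately show "\<exists>y\<in>H - {0}. x = y\<^sup>2" by blast
next
  assume "\<exists>y\<in>H - {0}. x = y\<^sup>2"
  then obtain y where "y \<in> R \<union> uminus ` R" "x = y\<^sup>2" unfolding half by blast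
  then show "x \<in> R" using R_mult by (auto simp: power2_eq_square)
qed

end

section \<open>Isomorphisms\<close>

lemma of_int_poly_smult:
  "of_int_poly (smult c P) = smult (of_int c) (of_int_poly P :: 'a::comm_ring_1 poly)"
  by (rule poly_eqI) (simp add: coeff_map_poly)

text \<open>Multiplication by \<open>u\<close> is injective on a finite set, hence surjective, and
  so reaches 1.\<close>

lemma int_adjoin_inverse:
  fixes w :: "'a::{field,finite}"
  assumes u: "u \<in> int_adjoin w" "u \<noteq> 0"
  obtains v where "v \<in> int_adjoin w" "u * v = 1"
proof -
  have "(*) u ` int_adjoin w = int_adjoin w"
    by (rule endo_inj_surj) (use u int_adjoin_mult in \<open>auto simp: inj_on_def\<close>)
  moreover have "1 \<in> int_adjoin w" using int_adjoin_power[of w 0] by simp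
  ultimately have "1 \<in> (*) u ` int_adjoin w" by simp
  then show thesis using that by auto
qed

text \<open>
  Uniqueness of finite fields: with \<open>f\<close> a monic integer polynomial of minimal degree vanishing at
  \<open>w\<close>, every integer polynomial vanishing at \<open>w\<close> lies in the ideal generated by \<open>f\<close> and \<open>p\<close>. Since
  \<open>X\<^sup>h - X\<close> is such a polynomial and splits over the second field, \<open>f\<close> has a root \<open>\<beta>\<close> there, and
  \<open>w \<mapsto> \<beta>\<close> extends to a ring isomorphism.
\<close>

lemma int_adjoin_iso:
  fixes w :: "'a::{field,finite}"
  assumes p: "prime p" and char_a: "CHAR('a) = p" and char_b: "CHAR('b::{field,finite}) = p"
    and card: "card (int_adjoin w) = CARD('b::{field,finite})" and w: "w \<noteq> 0"
  obtains \<phi> :: "'a \<Rightarrow> 'b::{field,finite}" where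
    "bij_betw \<phi> (int_adjoin w) UNIV"
    "\<And>x y. x \<in> int_adjoin w \<Longrightarrow> y \<in> int_adjoin w \<Longrightarrow> \<phi> (x - y) = \<phi> x - \<phi> y"
    "\<And>x y. x \<in> int_adjoin w \<Longrightarrow> y \<in> int_adjoin w \<Longrightarrow> \<phi> (x * y) = \<phi> x * \<phi> y"
proof -
  let ?H = "int_adjoin w"
  define h where "h = CARD('b)"
  have H: "diff_closed ?H" by (rule diff_closed_int_adjoin)
  have pa: "(of_int (int p) :: 'a) = 0" using char_a of_nat_CHAR[where 'a = 'a] by simp
  have pb: "(of_int (int p) :: 'b) = 0" using char_b of_nat_CHAR[where 'a = 'b] by simp
  define ev where "ev P = poly (of_int_poly P) w" for P :: "int poly"
  have ev_diff: "ev (P - Q) = ev P - ev Q" for P Q by (simp add: ev_def of_int_poly_hom.hom_minus)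
  have ev_mult: "ev (P * Q) = ev P * ev Q" for P Q by (simp add: ev_def of_int_poly_hom.hom_mult)
  have ev_smult: "ev (smult c P) = of_int c * ev P" for c P by (simp add: ev_def of_int_poly_smult)
  have h2: "h \<ge> 2"
    using card_mono[of "UNIV :: 'b set" "{0, 1}"] by (simp add: h_def)
  define XX :: "int poly" where "XX = monom 1 h - monom 1 1"
  have "w ^ card (?H - {0}) = 1"
    by (rule power_card_eq_1) (use w int_adjoin_mult[OF int_adjoin_power[of w 1]] in auto)
  then have "w ^ (h - 1) = 1"
    using diff_closed_0[OF H] card by (simp add: h_def card_Diff_singleton)
  then have "w ^ h = w" using h2 power_minus_mult[of h w] by simp
  then have ev_XX: "ev XX = 0" by (simp add: XX_def ev_def of_int_poly_hom.hom_minus poly_monom)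
  have coeff_XX: "coeff XX h = 1" "\<forall>i>h. coeff XX i = 0" using h2 by (auto simp: XX_def)
  \<comment> \<open>Some monic integer polynomial of degree \<open>d\<close> vanishes at
    \<open>w\<close>.\<close>
  let ?Q = "\<lambda>d. \<exists>f. coeff f d = 1 \<and> (\<forall>i>d. coeff f i = 0) \<and> ev f = 0"
  define d where "d = (LEAST d. ?Q d)"
  have "?Q h" using ev_XX coeff_XX by blast
  then have "?Q d" unfolding d_def by (rule LeastI)
  then obtain f where f: "coeff f d = 1" "\<forall>i>d. coeff f i = 0" "ev f = 0" by blast
  have min: "\<not> ?Q e" if "e < d" for e using that unfolding d_def by (rule not_less_Least)
  have "d \<noteq> 0"
  proof
    assume "d = 0"
    then have "f = 1" using f by (intro poly_eqI) (auto simp: coeff_1)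
    then show False using f(3) by (simp add: ev_def)
  qed
  \<comment> \<open>Induction on a degree bound: from degree \<open>d\<close> on, a multiple of
    \<open>f\<close> removes the top term; below \<open>d\<close>, minimality forces the top
    coefficient to be divisible by \<open>p\<close>.\<close>
  have ideal: "\<exists>Q r. P = f * Q + smult (int p) r" if "\<forall>i\<ge>N. coeff P i = 0" "ev P = 0" for P N
    using that
  proof (induction N arbitrary: P)
    case 0
    then have "P = f * 0 + smult (int p) 0" by (intro poly_eqI) simp
    then show ?case by blast
  next
    case (Suc N)
    define c where "c = coeff P N"
    have high: "coeff P i = 0" if "i > N" for i using Suc.prems(1) that by simp
    show ?case
    proof (cases "d \<le> N")
      case True
      define P' where "P' = P - monom c (N - d) * f"
      have "\<forall>i\<ge>N. coeff P' i = 0"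
      proof (intro allI impI)
        fix i assume "i \<ge> N"
        then show "coeff P' i = 0"
          using True f high[of i] by (cases "i = N") (auto simp: P'_def c_def coeff_monom_mult)
      qed
      moreover have "ev P' = 0" using Suc.prems f by (simp add: P'_def ev_diff ev_mult)
      ultimately obtain Q r where "P' = f * Q + smult (int p) r" using Suc.IH by blast
      then have "P = f * (Q + monom c (N - d)) + smult (int p) r"
        by (simp add: P'_def algebra_simps)
      then show ?thesis by blast
    next
      case False
      have "int p dvd c"
      proof (rule ccontr)
        assume "\<not> int p dvd c"
        then have "coprime c (int p)"
          using prime_imp_coprime[of "int p" c] p by (simp add: coprime_commute)
        then obtain c' where "[c * c' = 1] (mod int p)" by (metis cong_solve_coprime_int)
        then have "int p dvd c * c' - 1" by (simp add: cong_iff_dvd_diff)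
        then obtain t where t: "c * c' - 1 = int p * t" ..
        \<comment> \<open>Scaling by the inverse \<open>c'\<close> modulo \<open>p\<close> and
          correcting by a multiple of \<open>p\<close> gives a monic polynomial of degree
          \<open>N < d\<close> vanishing at \<open>w\<close>.\<close>
        define F where "F = smult c' P - smult (int p) (monom t N)"
        have "coeff F N = 1" using t by (simp add: F_def c_def algebra_simps)
        moreover have "\<forall>i>N. coeff F i = 0" using high by (simp add: F_def)
        moreover have "ev F = 0" unfolding F_def ev_diff ev_smult pa Suc.prems(2) by simp
        ultimately show False using min[of N] False by auto
      qed
      then obtain t where t: "c = int p * t" ..
      define P' where "P' = P - smult (int p) (monom t N)"
      have "\<forall>i\<ge>N. coeff P' i = 0"
        using high t by (auto simp: P'_def c_def le_less)
      moreover have "ev P' = 0" unfolding P'_def ev_diff ev_smult pa Suc.prems(2) by simp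
      ultimately obtain Q r where "P' = f * Q + smult (int p) r" using Suc.IH by blast
      then have "P = f * Q + smult (int p) (r + monom t N)"
        by (simp add: P'_def smult_add_right algebra_simps)
      then show ?thesis by blast
    qed
  qed
  have "\<forall>i\<ge>Suc h. coeff XX i = 0" using coeff_XX by simp
  from ideal[OF this ev_XX] obtain Q r where XX: "XX = f * Q + smult (int p) r" by (elim exE)
  define F where "F = (of_int_poly f :: 'b poly)"
  define G where "G = (of_int_poly Q :: 'b poly)"
  define Y where "Y = (of_int_poly XX :: 'b poly)"
  have "Y = F * G + of_int_poly (smult (int p) r)"
    by (simp add: Y_def XX F_def G_def of_int_poly_hom.hom_add of_int_poly_hom.hom_mult)
  also have "of_int_poly (smult (int p) r) = (0 :: 'b poly)"
    unfolding of_int_poly_smult pb by simp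
  finally have Y: "Y = F * G" by simp
  have coeff_Y: "coeff Y i = of_int (coeff XX i)" for i by (simp add: Y_def coeff_map_poly)
  have deg_Y: "degree Y \<le> h" using coeff_XX by (intro degree_le) (simp add: coeff_Y)
  have "coeff Y h = 1" using coeff_XX by (simp add: coeff_Y)
  then have "Y \<noteq> 0" by (metis coeff_0 zero_neq_one)
  then have FG: "F \<noteq> 0" "G \<noteq> 0" using Y by auto
  have "coeff F d = 1" using f(1) by (simp add: F_def coeff_map_poly)
  then have "d \<le> degree F" by (intro le_degree) simp
  \<comment> \<open>\<open>F\<close> has positive degree, so \<open>G\<close> has too few roots to
    account for all \<open>h\<close> zeros of \<open>Y\<close>; some zero must come from
    \<open>F\<close>.\<close>
  have "degree G < h"
    using deg_Y \<open>d \<noteq> 0\<close> \<open>d \<le> degree F\<close> degree_mult_eq[OF FG] Y by simp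
  have "\<exists>\<beta>. poly F \<beta> = 0"
  proof (rule ccontr)
    assume no: "\<nexists>\<beta>. poly F \<beta> = 0"
    have "poly Y \<beta> = 0" for \<beta>
      using finite_field_power_CARD[of \<beta>]
      by (simp add: Y_def XX_def of_int_poly_hom.hom_minus poly_monom h_def)
    then have "poly G \<beta> = 0" for \<beta> using no Y by (metis mult_eq_0_iff poly_mult)
    then have "h \<le> degree G" using card_poly_roots_bound[OF FG(2)] by (simp add: h_def)
    then show False using \<open>degree G < h\<close> by simp
  qed
  then obtain \<beta> where \<beta>: "poly F \<beta> = 0" ..
  define ev' where "ev' P = poly (of_int_poly P) \<beta>" for P :: "int poly"
  have ev'_diff: "ev' (P - Q) = ev' P - ev' Q" for P Q by (simp add: ev'_def of_int_poly_hom.hom_minus)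
  have ev'_mult: "ev' (P * Q) = ev' P * ev' Q" for P Q by (simp add: ev'_def of_int_poly_hom.hom_mult)
  have ev'_0: "ev' P = 0" if "ev P = 0" for P
  proof -
    have "\<forall>i\<ge>Suc (degree P). coeff P i = 0" by (simp add: coeff_eq_0)
    from ideal[OF this that] obtain Q r where P: "P = f * Q + smult (int p) r" by (elim exE)
    have "ev' P = ev' f * ev' Q + of_int (int p) * ev' r"
      by (simp add: P ev'_def of_int_poly_smult of_int_poly_hom.hom_add of_int_poly_hom.hom_mult)
    then show ?thesis using \<beta> unfolding pb by (simp add: ev'_def F_def)
  qed
  have ev'_cong: "ev' P = ev' Q" if "ev P = ev Q" for P Q
    using ev'_0[of "P - Q"] that by (simp add: ev_diff ev'_diff)
  define \<phi> where "\<phi> x = ev' (SOME P. ev P = x)" for x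
  have \<phi>: "\<phi> (ev P) = ev' P" for P
    unfolding \<phi>_def by (rule ev'_cong) (rule someI[of _ P], rule refl)
  have H_ev: "\<exists>P. x = ev P" if "x \<in> ?H" for x using that by (auto simp: int_adjoin_def ev_def)
  have diff: "\<phi> (x - y) = \<phi> x - \<phi> y" if "x \<in> ?H" "y \<in> ?H" for x y
    using H_ev[OF that(1)] H_ev[OF that(2)] by (auto simp: \<phi> ev'_diff ev_diff[symmetric])
  have mult: "\<phi> (x * y) = \<phi> x * \<phi> y" if "x \<in> ?H" "y \<in> ?H" for x y
    using H_ev[OF that(1)] H_ev[OF that(2)] by (auto simp: \<phi> ev'_mult ev_mult[symmetric])
  have "\<phi> 1 = 1" using \<phi>[of 1] by (simp add: ev_def ev'_def)
  \<comment> \<open>A nonzero difference sent to 0 is invertible in the subring, which would give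
    \<open>\<phi> 1 = 0\<close>.\<close>
  have inj: "inj_on \<phi> ?H"
  proof (rule inj_onI, rule ccontr)
    fix x y assume xy: "x \<in> ?H" "y \<in> ?H" "\<phi> x = \<phi> y" "x \<noteq> y"
    then have u: "x - y \<in> ?H" "x - y \<noteq> 0" "\<phi> (x - y) = 0"
      by (simp_all add: diff_closed_diff[OF H] diff)
    obtain v where "v \<in> ?H" "(x - y) * v = 1" by (rule int_adjoin_inverse[OF u(1,2)])
    then have "\<phi> 1 = 0" using mult[OF u(1), of v] u(3) by simp
    then show False using \<open>\<phi> 1 = 1\<close> by simp
  qed
  have "\<phi> ` ?H = UNIV"
    by (rule card_subset_eq) (simp_all add: card_image[OF inj] card)
  then have "bij_betw \<phi> ?H UNIV" using inj by (simp add: bij_betw_def)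
  then show thesis using diff mult by (rule that)
qed

text \<open>All arcs stay within cosets of \<open>H\<close>. Each of the \<open>N\<close> cosets is
  translated to \<open>H\<close> and carried over by \<open>\<phi>\<close>, and a bijection
  \<open>e\<close> numbers the cosets.\<close>

lemma gen_paley_iso_disjoint_copies:
  fixes \<phi> :: "'a::{field,finite} \<Rightarrow> 'b::{field,finite}"
  assumes H: "diff_closed H" and sub: "nonzero_powers k \<subseteq> H"
    and bij: "bij_betw \<phi> H UNIV"
    and diff: "\<And>x y. x \<in> H \<Longrightarrow> y \<in> H \<Longrightarrow> \<phi> (x - y) = \<phi> x - \<phi> y"
    and powers: "\<And>x. x \<in> H \<Longrightarrow> \<phi> x \<in> nonzero_powers l \<longleftrightarrow> x \<in> nonzero_powers k"
    and card: "CARD('a) = N * card H"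
  shows "digraph_iso (gen_paley k :: ('a, 'a \<times> 'a) pre_digraph)
    (disjoint_copies N (gen_paley l :: ('b, 'b \<times> 'b) pre_digraph))"
proof -
  \<comment> \<open>The chosen representative depends only on the coset of \<open>x\<close>, because
    the predicate does (\<open>rep_eq\<close>).\<close>
  define rep where "rep x = (SOME y. x - y \<in> H)" for x
  have rep: "x - rep x \<in> H" for x
    unfolding rep_def by (rule someI[of _ x]) (simp add: diff_closed_0[OF H])
  have rep_eq: "rep x = rep y" if "x - y \<in> H" for x y
  proof -
    have "x - z \<in> H \<longleftrightarrow> y - z \<in> H" for z
      using diff_closed_diff[OF H, of "x - z" "x - y"] diff_closed_add[OF H, of "y - z" "x - y"] that
      by auto
    then show ?thesis by (simp add: rep_def)
  qed
  have rep_rep: "rep (rep x + y) = rep x" if "y \<in> H" for x y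
    using rep_eq[of x "rep x + y"] diff_closed_diff[OF H rep[of x] that] by (simp add: algebra_simps)
  have bij_rep: "bij_betw (\<lambda>x. (rep x, x - rep x)) UNIV (range rep \<times> H)"
    by (rule bij_betw_byWitness[where f' = "\<lambda>(t, y). t + y"]) (auto simp: rep rep_rep)
  have "card (range rep) * card H = CARD('a)"
    using bij_betw_same_card[OF bij_rep] by (simp add: card_cartesian_product)
  moreover have "card H > 0" using diff_closed_0[OF H] by (auto simp: card_gt_0_iff)
  ultimately have "card (range rep) = N" using card by (metis mult_cancel2 less_numeral_extra(3))
  then obtain e where e: "bij_betw e (range rep) {..<N}"
    using finite_same_card_bij[of "range rep" "{..<N}"] by auto
  define v where "v x = (e (rep x), \<phi> (x - rep x))" for x
  have v_bij: "bij_betw v UNIV ({..<N} \<times> UNIV)"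
  proof -
    have "v = map_prod e \<phi> \<circ> (\<lambda>x. (rep x, x - rep x))" by (auto simp: v_def)
    then show ?thesis
      using bij_betw_trans[OF bij_rep bij_betw_map_prod[OF e bij]] by simp
  qed
  have v_inj: "v x = v y \<longleftrightarrow> x = y" for x y
    using v_bij by (auto simp: bij_betw_def inj_on_def)
  have v_arc: "y - x \<in> nonzero_powers k \<longleftrightarrow>
      fst (v x) = fst (v y) \<and> snd (v y) - snd (v x) \<in> nonzero_powers l" for x y
  proof (cases "y - x \<in> H")
    case True
    then have eq: "rep y = rep x" by (rule rep_eq)
    have "snd (v y) - snd (v x) = \<phi> ((y - rep x) - (x - rep x))"
      using diff[OF rep[of y] rep[of x]] eq by (simp add: v_def)
    then show ?thesis using powers[OF True] eq by (simp add: v_def)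
  next
    case False
    have "rep x \<noteq> rep y"
    proof
      assume "rep x = rep y"
      then have "(y - rep y) - (x - rep y) \<in> H" using diff_closed_diff[OF H rep[of y] rep[of x]] by simp
      then show False using False by simp
    qed
    then have "fst (v x) \<noteq> fst (v y)" using e by (auto simp: v_def bij_betw_def inj_on_def)
    then show ?thesis using False sub by auto
  qed
  let ?\<Gamma> = "gen_paley k :: ('a, 'a \<times> 'a) pre_digraph"
  \<comment> \<open>An arc of the disjoint union stores its copy index once. It is taken from the
    tail and agrees with that of the head by \<open>v_arc\<close>.\<close>
  define iso :: "('a, 'a \<times> 'a, nat \<times> 'b, nat \<times> 'b \<times> 'b) digraph_isomorphism" where
    "iso = \<lparr> iso_verts = v, iso_arcs = (\<lambda>(x, y). (fst (v x), snd (v x), snd (v y))),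
       iso_head = map_prod id snd, iso_tail = map_prod id fst \<rparr>"
  have arcs: "arcs ?\<Gamma> = {(x, y). y - x \<in> nonzero_powers k}" by (simp add: gen_paley_def)
  have inj_arcs: "inj_on (iso_arcs iso) (arcs ?\<Gamma>)"
  proof (rule inj_onI, clarify)
    fix x y x' y'
    assume "(x, y) \<in> arcs ?\<Gamma>" "(x', y') \<in> arcs ?\<Gamma>" and eq: "iso_arcs iso (x, y) = iso_arcs iso (x', y')"
    then have "fst (v x) = fst (v y)" "fst (v x') = fst (v y')" by (simp_all add: arcs v_arc)
    then have "v x = v x'" "v y = v y'" using eq by (simp_all add: iso_def prod_eq_iff)
    then show "x = x' \<and> y = y'" by (simp add: v_inj)
  qed
  have "pre_digraph.digraph_isomorphism ?\<Gamma> iso"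
    unfolding pre_digraph.digraph_isomorphism_def
  proof (intro conjI ballI)
    show "wf_digraph ?\<Gamma>" by unfold_locales (auto simp: gen_paley_def)
    show "inj_on (iso_verts iso) (verts ?\<Gamma>)" by (auto simp: iso_def inj_on_def v_inj)
    fix a assume "a \<in> arcs ?\<Gamma>"
    then show "iso_verts iso (tail ?\<Gamma> a) = iso_tail iso (iso_arcs iso a)"
      "iso_verts iso (head ?\<Gamma> a) = iso_head iso (iso_arcs iso a)"
      by (auto simp: iso_def gen_paley_def v_arc prod_eq_iff split: prod.splits)
  qed (rule inj_arcs)
  moreover have "disjoint_copies N (gen_paley l :: ('b, 'b \<times> 'b) pre_digraph) = app_iso iso ?\<Gamma>"
  proof -
    have "v ` UNIV = {..<N} \<times> UNIV" using v_bij by (simp add: bij_betw_def)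
    moreover have "iso_arcs iso ` arcs ?\<Gamma> = {..<N} \<times> {(b, b'). b' - b \<in> nonzero_powers l}"
    proof (intro equalityI subsetI)
      fix z :: "nat \<times> 'b \<times> 'b" assume "z \<in> iso_arcs iso ` arcs ?\<Gamma>"
      then obtain x y where "z = (fst (v x), snd (v x), snd (v y))" "y - x \<in> nonzero_powers k"
        by (auto simp: iso_def arcs)
      moreover have "fst (v x) < N"
        using \<open>v ` UNIV = {..<N} \<times> UNIV\<close> by (metis UNIV_I imageI lessThan_iff mem_Times_iff)
      ultimately show "z \<in> {..<N} \<times> {(b, b'). b' - b \<in> nonzero_powers l}" by (simp add: v_arc)
    next
      fix z :: "nat \<times> 'b \<times> 'b" assume "z \<in> {..<N} \<times> {(b, b'). b' - b \<in> nonzero_powers l}"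
      then obtain i b b' where z: "z = (i, b, b')" "i < N" "b' - b \<in> nonzero_powers l" by auto
      then have "(i, b) \<in> v ` UNIV" "(i, b') \<in> v ` UNIV"
        using \<open>v ` UNIV = {..<N} \<times> UNIV\<close> by auto
      then obtain x y where xy: "v x = (i, b)" "v y = (i, b')" by (metis imageE)
      then have "(x, y) \<in> arcs ?\<Gamma>" using z by (simp add: arcs v_arc)
      moreover have "z = iso_arcs iso (x, y)" using xy z by (simp add: iso_def)
      ultimately show "z \<in> iso_arcs iso ` arcs ?\<Gamma>" by blast
    qed
    ultimately show ?thesis
      by (simp add: app_iso_def disjoint_copies_def iso_def gen_paley_def)
  qed
  ultimately show ?thesis unfolding digraph_iso_def by blast
qed

section \<open>Directed generalized Paley graphs\<close>

text \<open>Odd squares are 1 modulo 4, and so are all powers of a number that is 1 modulo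
  4.\<close>

lemma power_mod_4_eq_3:
  fixes p a :: nat
  assumes "odd p" "p ^ a mod 4 = 3"
  shows "odd a" and "p mod 4 = 3"
proof -
  have mod4: "p mod 4 = 1 \<or> p mod 4 = 3" using \<open>odd p\<close> by presburger
  show "odd a"
  proof
    assume "even a"
    then obtain b where b: "a = 2 * b" by (rule evenE)
    have "(p mod 4)\<^sup>2 mod 4 = 1" using mod4 by auto
    then have "[p\<^sup>2 = 1] (mod 4)" by (simp add: cong_def power_mod)
    then have "[(p\<^sup>2) ^ b = 1 ^ b] (mod 4)" by (rule cong_pow)
    then show False using assms(2) b by (simp add: cong_def power_mult)
  qed
  show "p mod 4 = 3"
  proof (rule ccontr)
    assume "p mod 4 \<noteq> 3"
    then have "[p = 1] (mod 4)" using mod4 by (simp add: cong_def)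
    then have "[p ^ a = 1 ^ a] (mod 4)" by (rule cong_pow)
    then show False using assms(2) by (simp add: cong_def)
  qed
qed

theorem theorem6p2:
  fixes p m k q n a :: nat
    and \<Gamma> :: "('a::{field,finite}, 'a \<times> 'a) pre_digraph"
  assumes "prime p" and "odd p" and "m \<ge> 1"
    and "q = p ^ m" and "CARD('a) = q"
    and "k dvd q - 1"
    and "\<Gamma> = gen_paley k"
    and "n = (q - 1) div k" and "a = ord n p"
    and directed: "\<not> symmetric \<Gamma>"
  shows "num_distinct_eigenvalues \<Gamma> \<ge> 3
    \<and> (num_distinct_eigenvalues \<Gamma> = 3 \<longleftrightarrow>
         real k = 2 * ((real p ^ m - 1) / (real p ^ a - 1)) \<and> [p ^ a = 3] (mod 4))
    \<and> (num_distinct_eigenvalues \<Gamma> = 3 \<longrightarrow>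
         odd a \<and> [p = 3] (mod 4)
         \<and> (CARD('b::{field,finite}) = p ^ a \<longrightarrow>
              digraph_iso \<Gamma>
                (disjoint_copies (p ^ (m - a)) (gen_paley 2 :: ('b, 'b \<times> 'b) pre_digraph)))
         \<and> graph_Spec \<Gamma> =
             replicate_mset (p ^ (m - a)) ((of_nat p ^ a - 1) / 2)
           + replicate_mset ((p ^ a - 1) div 2 * p ^ (m - a))
               ((- 1 + \<i> * of_nat p ^ ((a - 1) div 2) * of_real (sqrt (real p))) / 2)
           + replicate_mset ((p ^ a - 1) div 2 * p ^ (m - a))
               ((- 1 - \<i> * of_nat p ^ ((a - 1) div 2) * of_real (sqrt (real p))) / 2))"
proof -
  note p = \<open>prime p\<close>
  have p1: "p > 1" using p by (rule prime_gt_1_nat)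
  have card_a: "CARD('a) = p ^ m" using assms by simp
  have char_a: "CHAR('a) = p" by (rule CHAR_finite_field[OF p card_a])
  have q: "q > 1" using one_less_power[OF p1, of m] \<open>m \<ge> 1\<close> \<open>q = p ^ m\<close> by simp
  have kn: "k * n = q - 1" using assms by simp
  then have "k * n \<noteq> 0" using q by simp
  then have k: "k > 0" and n: "n > 0" by simp_all
  have neg1: "(- 1 :: 'a) \<noteq> 1"
  proof
    assume "(- 1 :: 'a) = 1"
    then have "(of_nat 2 :: 'a) = 0" by (metis add.right_inverse of_nat_1 of_nat_add one_add_one)
    then have "p dvd 2" using char_a of_nat_eq_0_iff_char_dvd by metis
    then show False using \<open>odd p\<close> p by (metis primes_dvd_imp_eq two_is_prime_nat even_numeral)
  qed
  obtain w :: 'a where w: "w \<noteq> 0" "nonzero_powers k = range (\<lambda>i::nat. w ^ i)"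
    "\<And>i. w ^ i = 1 \<longleftrightarrow> n dvd i"
    by (rule nonzero_powers_generator[where 'a = 'a, of k n]) (use assms in simp_all)
  \<comment> \<open>For even \<open>n\<close> the middle power of \<open>w\<close> is -1, so the set
    of \<open>k\<close>-th powers is closed under negation and the graph is symmetric.\<close>
  have odd: "odd n"
  proof
    assume "even n"
    then obtain j where j: "n = 2 * j" by (rule evenE)
    then have "(w ^ j)\<^sup>2 = 1" using w(3)[of n] by (simp add: power_mult[symmetric] mult.commute)
    moreover have "w ^ j \<noteq> 1" using n j by (auto simp: w(3) dest: dvd_imp_le)
    ultimately have minus: "w ^ j = - 1" by (simp add: power2_eq_1_iff)
    have "- x \<in> nonzero_powers k" if "x \<in> nonzero_powers k" for x :: 'a
    proof -
      obtain i where "x = w ^ i" using \<open>x \<in> nonzero_powers k\<close> w(2) by auto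
      then have "- x = w ^ (j + i)" by (simp add: power_add minus)
      then show ?thesis using w(2) by auto
    qed
    then have "(nonzero_powers k :: 'a set) = uminus ` nonzero_powers k"
      by (metis (no_types, opaque_lifting) image_eqI image_subset_iff minus_minus subsetI subset_antisym)
    then show False using directed symmetric_gen_paley_iff \<open>\<Gamma> = gen_paley k\<close> by blast
  qed
  obtain \<psi> :: "'a \<Rightarrow> complex" where \<psi>: "additive_character \<psi>"
    using additive_character_exists[OF p char_a] by blast
  then interpret S: odd_cyclic_subgroup \<psi> w n
    by (intro odd_cyclic_subgroup.intro odd_cyclic_subgroup_axioms.intro) (use w odd neg1 in auto)
  have R: "nonzero_powers k = S.R" using w(2) by (simp add: S.R_def)
  have spec: "graph_Spec \<Gamma> = image_mset (S.period S.R) (mset_set UNIV)"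
    using S.graph_Spec_gen_paley[of k] R \<open>\<Gamma> = gen_paley k\<close> by simp
  then have num: "num_distinct_eigenvalues \<Gamma> = card (range (S.period S.R))"
    by (simp add: num_distinct_eigenvalues_eq_card_graph_Spec)
  have card_H: "card S.H = p ^ a"
    using card_int_adjoin[OF p card_a w(1) w(3)] \<open>a = ord n p\<close> by simp
  have mset: "image_mset (S.period S.R) (mset_set UNIV) =
    replicate_mset (card (S.annihilator S.H)) (of_nat n)
    + replicate_mset (n * card (S.annihilator S.H)) ((- 1 + \<i> * of_real (sqrt (card S.H))) / 2)
    + replicate_mset (n * card (S.annihilator S.H)) ((- 1 - \<i> * of_real (sqrt (card S.H))) / 2)"
    if "p ^ a = 2 * n + 1"
    using that S.image_mset_period S.H_eq_iff_card card_H by metis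
  have ge3: "num_distinct_eigenvalues \<Gamma> \<ge> 3"
    using S.card_range_period_ge_3 num by simp
  \<comment> \<open>Forwards, three periods force \<open>H\<close> to have \<open>2 * n + 1\<close>
    elements; backwards, the explicit multiset has at most three values and \<open>ge3\<close>
    supplies the other bound.\<close>
  have three_iff: "num_distinct_eigenvalues \<Gamma> = 3 \<longleftrightarrow> p ^ a = 2 * n + 1"
  proof
    assume "num_distinct_eigenvalues \<Gamma> = 3"
    then show "p ^ a = 2 * n + 1"
      using S.three_periods_imp S.H_eq_iff_card num card_H by simp
  next
    assume half: "p ^ a = 2 * n + 1"
    let ?X = "{of_nat n, (- 1 + \<i> * of_real (sqrt (card S.H))) / 2,
      (- 1 - \<i> * of_real (sqrt (card S.H))) / 2} :: complex set"
    have "set_mset (graph_Spec \<Gamma>) \<subseteq> ?X"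
      unfolding spec mset[OF half] by (auto split: if_splits)
    then have "card (set_mset (graph_Spec \<Gamma>)) \<le> card ?X" by (intro card_mono) auto
    also have "\<dots> \<le> 3" by (simp add: card_insert_if)
    finally show "num_distinct_eigenvalues \<Gamma> = 3"
      using ge3 by (simp add: num_distinct_eigenvalues_eq_card_graph_Spec)
  qed
  \<comment> \<open>Because \<open>n\<close> divides \<open>p ^ m - 1\<close>; this makes the order
    \<open>a\<close> positive.\<close>
  have "coprime n p"
  proof -
    have "[p ^ m = 1] (mod n)" using kn q \<open>q = p ^ m\<close> by (metis cong_altdef_nat dvd_triv_right less_imp_le)
    then show ?thesis
      by (metis \<open>m \<ge> 1\<close> ord_divides ord_gt_0_iff dvd_0_left gr0I not_one_le_zero)
  qed
  then have a: "a > 0" using \<open>a = ord n p\<close> by simp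
  have pa: "p ^ a > 1" using p1 a by (rule one_less_power)
  \<comment> \<open>Since \<open>k * n = p ^ m - 1\<close>, the formula for \<open>k\<close> says
    \<open>p ^ a - 1 = 2 * n\<close>; writing \<open>n = 2 * j + 1\<close> then gives
    \<open>p ^ a = 4 * j + 3\<close>.\<close>
  have cond_iff: "p ^ a = 2 * n + 1 \<longleftrightarrow>
      real k = 2 * ((real p ^ m - 1) / (real p ^ a - 1)) \<and> [p ^ a = 3] (mod 4)"
  proof -
    have "real 1 < real (p ^ a)" using pa by (simp only: of_nat_less_iff)
    then have pos: "real p ^ a - 1 > 0" by simp
    have "real (k * n) = real (p ^ m) - 1"
      using kn q \<open>q = p ^ m\<close> by (simp add: of_nat_diff)
    then have qk: "real p ^ m - 1 = real k * real n" by simp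
    have "real k = 2 * ((real p ^ m - 1) / (real p ^ a - 1)) \<longleftrightarrow> real k * (real p ^ a - 1) = real k * (2 * real n)"
      using pos unfolding qk by (auto simp: field_simps)
    also have "\<dots> \<longleftrightarrow> real (p ^ a) = real (2 * n + 1)" using k by auto
    also have "\<dots> \<longleftrightarrow> p ^ a = 2 * n + 1" by (rule of_nat_eq_iff)
    finally have iff: "real k = 2 * ((real p ^ m - 1) / (real p ^ a - 1)) \<longleftrightarrow> p ^ a = 2 * n + 1" .
    have "[p ^ a = 3] (mod 4)" if "p ^ a = 2 * n + 1"
    proof -
      obtain j where "n = 2 * j + 1" using odd by (rule oddE)
      then show ?thesis unfolding that by (simp add: cong_def)
    qed
    then show ?thesis using iff by blast
  qed
  have "odd a \<and> [p = 3] (mod 4) \<and> (CARD('b) = p ^ a \<longrightarrow>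
          digraph_iso \<Gamma> (disjoint_copies (p ^ (m - a)) (gen_paley 2 :: ('b, 'b \<times> 'b) pre_digraph)))
         \<and> graph_Spec \<Gamma> =
             replicate_mset (p ^ (m - a)) ((of_nat p ^ a - 1) / 2)
           + replicate_mset ((p ^ a - 1) div 2 * p ^ (m - a))
               ((- 1 + \<i> * of_nat p ^ ((a - 1) div 2) * of_real (sqrt (real p))) / 2)
           + replicate_mset ((p ^ a - 1) div 2 * p ^ (m - a))
               ((- 1 - \<i> * of_nat p ^ ((a - 1) div 2) * of_real (sqrt (real p))) / 2)"
    if three: "num_distinct_eigenvalues \<Gamma> = 3"
  proof (intro conjI impI)
    have half: "p ^ a = 2 * n + 1" using three three_iff by simp
    then have half_H: "S.H - {0} = S.R \<union> uminus ` S.R" using S.H_eq_iff_card card_H by simp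
    have mod4: "p ^ a mod 4 = 3" using half cond_iff by (simp add: cong_def)
    show odd_a: "odd a" and "[p = 3] (mod 4)"
      using power_mod_4_eq_3[OF \<open>odd p\<close> mod4] by (simp_all add: cong_def)
    \<comment> \<open>Besides the size of the annihilator, this yields \<open>a \<le> m\<close>, so
      the natural subtraction \<open>m - a\<close> is a true difference.\<close>
    have card_A: "p ^ a * card (S.annihilator S.H) = p ^ m"
      using S.card_annihilator[OF diff_closed_int_adjoin, of w] card_H card_a by simp
    then have "p ^ a dvd p ^ m" by (metis dvd_triv_left)
    then have "a \<le> m" using p1 by (simp add: power_dvd_imp_le)
    then have pm: "p ^ m = p ^ a * p ^ (m - a)" by (simp add: power_add[symmetric])
    then have A: "card (S.annihilator S.H) = p ^ (m - a)" using card_A p1 by simp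
    obtain b where b: "a = 2 * b + 1" using odd_a by (rule oddE)
    \<comment> \<open>As \<open>a = 2 * b + 1\<close>, exactly one factor \<open>p\<close> remains
      under the root.\<close>
    have "sqrt (card S.H) = sqrt (real p * (real p ^ b)\<^sup>2)"
      unfolding card_H b by (simp add: power_even_eq)
    then have sqrt_H: "sqrt (card S.H) = real p ^ ((a - 1) div 2) * sqrt p"
      unfolding real_sqrt_mult b by simp
    have "(of_nat (p ^ a) :: complex) = of_nat (2 * n + 1)" using half by simp
    then have n1: "(of_nat n :: complex) = (of_nat p ^ a - 1) / 2" by simp
    have n2: "n = (p ^ a - 1) div 2" using half by simp
    show "graph_Spec \<Gamma> =
             replicate_mset (p ^ (m - a)) ((of_nat p ^ a - 1) / 2)
           + replicate_mset ((p ^ a - 1) div 2 * p ^ (m - a))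
               ((- 1 + \<i> * of_nat p ^ ((a - 1) div 2) * of_real (sqrt (real p))) / 2)
           + replicate_mset ((p ^ a - 1) div 2 * p ^ (m - a))
               ((- 1 - \<i> * of_nat p ^ ((a - 1) div 2) * of_real (sqrt (real p))) / 2)"
      unfolding spec mset[OF half] sqrt_H A n1 n2[symmetric] by (simp add: mult.assoc)
    assume card_b: "CARD('b) = p ^ a"
    have char_b: "CHAR('b) = p" by (rule CHAR_finite_field[OF p card_b])
    have card_eq: "card S.H = CARD('b)" by (simp add: card_H card_b)
    obtain \<phi> :: "'a \<Rightarrow> 'b" where bij: "bij_betw \<phi> S.H UNIV"
      and diff: "\<And>x y. x \<in> S.H \<Longrightarrow> y \<in> S.H \<Longrightarrow> \<phi> (x - y) = \<phi> x - \<phi> y"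
      and mult: "\<And>x y. x \<in> S.H \<Longrightarrow> y \<in> S.H \<Longrightarrow> \<phi> (x * y) = \<phi> x * \<phi> y"
      by (rule int_adjoin_iso[OF p char_a char_b card_eq w(1)]) (rule that)
    have H: "diff_closed S.H" by (rule diff_closed_int_adjoin)
    have "\<phi> 0 = 0" using diff[OF diff_closed_0[OF H] diff_closed_0[OF H]] by simp
    then have zero: "\<phi> x = 0 \<longleftrightarrow> x = 0" if "x \<in> S.H" for x
      using bij diff_closed_0[OF H] that by (auto simp: bij_betw_def inj_on_def)
    show "digraph_iso \<Gamma> (disjoint_copies (p ^ (m - a)) (gen_paley 2 :: ('b, 'b \<times> 'b) pre_digraph))"
      unfolding \<open>\<Gamma> = gen_paley k\<close>
    proof (rule gen_paley_iso_disjoint_copies[OF H _ bij diff])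
      show "nonzero_powers k \<subseteq> S.H" using R S.R_subset_H by simp
      show "CARD('a) = p ^ (m - a) * card S.H" using card_a pm card_H by simp
      fix x assume x: "x \<in> S.H"
      \<comment> \<open>The bijection respects products, so it matches the nonzero squares of the
        second field with those of \<open>H\<close>, which form \<open>R\<close>.\<close>
      have "\<phi> x \<in> nonzero_powers 2 \<longleftrightarrow> (\<exists>y\<in>S.H - {0}. \<phi> x = \<phi> y * \<phi> y)"
      proof
        assume "\<phi> x \<in> nonzero_powers 2"
        then obtain z where z: "\<phi> x = z * z" "z \<noteq> 0"
          by (auto simp: nonzero_powers_def power2_eq_square)
        obtain y where "y \<in> S.H" "z = \<phi> y" using bij by (metis UNIV_I bij_betw_def imageE)
        then show "\<exists>y\<in>S.H - {0}. \<phi> x = \<phi> y * \<phi> y" using z zero by auto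
      next
        assume "\<exists>y\<in>S.H - {0}. \<phi> x = \<phi> y * \<phi> y"
        then obtain y where "y \<in> S.H" "y \<noteq> 0" "\<phi> x = \<phi> y * \<phi> y" by blast
        then show "\<phi> x \<in> nonzero_powers 2"
          using zero unfolding nonzero_powers_def power2_eq_square by blast
      qed
      also have "\<dots> \<longleftrightarrow> (\<exists>y\<in>S.H - {0}. x = y\<^sup>2)"
      proof (rule bex_cong[OF refl])
        fix y assume "y \<in> S.H - {0}"
        then have "\<phi> y * \<phi> y = \<phi> (y * y)" "y * y \<in> S.H" using mult int_adjoin_mult by auto
        then show "\<phi> x = \<phi> y * \<phi> y \<longleftrightarrow> x = y\<^sup>2"
          using bij x by (auto simp: bij_betw_def inj_on_def power2_eq_square)
      qed
      also have "\<dots> \<longleftrightarrow> x \<in> nonzero_powers k"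
        using S.R_iff_square[OF half_H] R by simp
      finally show "\<phi> x \<in> nonzero_powers 2 \<longleftrightarrow> x \<in> nonzero_powers k" .
    qed
  qed
  then show ?thesis using ge3 three_iff cond_iff by blast
qed

end
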